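(* Let $K$ be a compact Hausdorff space. Suppose $X_2\subseteq X_1$ are closed subspaces of $C(K)$, and $D\subseteq K$ is closed. If $(X_1|_D,X_1)$ and $(X_2|_D,X_2)$ both have the bounded extension property, $X_1|_D$ is separable and the pair $(X_1|_D,X_2|_D)$ has the $\lambda$-BAP, then there is a linear extension operator $T:X_1|_D\to X_1$ with $T(X_2|_D)\subseteq X_2$ (that is, $T$ is linear and $(Tf)(k)=f(k)$ for any $f\in X_1|_D$ and $k\in D$) with $\|T\|\le\lambda$.
   Context: For a closed subspace $X$ of $C(K)$ and closed $D\subseteq K$, $X|_D=\{f|_D: f\in X\}$ is the space of all restrictions, with the uniform norm on $D$. One says that $(X|_D,X)$ has the bounded extension property if there exists a constant $C$ such that, given $f\in X|_D$, $\varepsilon>0$ and an open set $U\supset D$, there is some $F\in X$ with $F|_D=f$, $\|F\|\le C\|f\|$, and $|F(x)|\le\varepsilon$ for $x\notin U$. For a Banach space $Z$ and closed subspace $Y$, the pair $(Z,Y)$ has the $\lambda$-BAP if for each $\varepsilon>0$ and each compact $A\subset Z$ there is a finite-rank linear map $S:Z\to Z$ with $\|S\|\le\lambda$, $\|S(z)-z\|\le\varepsilon$ for each $z\in A$, and $S(Y)\subseteq Y$. *)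

theory Defs
  imports "HOL-Analysis.Analysis" "HOL-Probability.Discrete_Topology"
begin

text \<open>
  Scalars: the sort \<open>{real_normed_field, euclidean_space}\<close> has \<open>real\<close> and \<open>complex\<close> as instances
  (up to isomorphism its only ones, by Gelfand--Mazur), so a type variable \<open>'s\<close> of this sort treats
  real and complex \<open>C(K)\<close> at once. Subspaces, spans and linear maps are taken over \<open>'s\<close>.

  \<open>C(K)\<close> is the type \<open>'k \<Rightarrow>\<^sub>C 's\<close> with its supremum norm, for a Hausdorff type \<open>'k\<close> with
  \<open>compact (UNIV :: 'k set)\<close>.
\<close>

definition scale_bcontfun ::
    "'s::real_normed_field \<Rightarrow> ('a::topological_space \<Rightarrow>\<^sub>C 's) \<Rightarrow> ('a \<Rightarrow>\<^sub>C 's)"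
  where "scale_bcontfun c f = Bcontfun (\<lambda>x. c * apply_bcontfun f x)"

lemma apply_scale_bcontfun [simp]:
  "apply_bcontfun (scale_bcontfun c f) x = c * apply_bcontfun f x"
proof -
  have "(\<lambda>x. c * apply_bcontfun f x) \<in> bcontfun"
    by (rule bcontfun_normI[where b = "norm c * norm f"])
      (auto intro!: continuous_intros mult_left_mono norm_bounded simp: norm_mult)
  then show ?thesis
    by (simp add: scale_bcontfun_def Bcontfun_inverse)
qed

lemma vector_space_scale_bcontfun:
  "vector_space
    (scale_bcontfun :: 's::real_normed_field \<Rightarrow> ('a::topological_space \<Rightarrow>\<^sub>C 's) \<Rightarrow> ('a \<Rightarrow>\<^sub>C 's))"
  by unfold_locales (auto intro!: bcontfun_eqI simp: algebra_simps)

definition linear_map_on ::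
    "('a::topological_space \<Rightarrow>\<^sub>C 's::real_normed_field) set
      \<Rightarrow> (('a \<Rightarrow>\<^sub>C 's) \<Rightarrow> ('b::topological_space \<Rightarrow>\<^sub>C 's)) \<Rightarrow> bool"
  where "linear_map_on Z T \<longleftrightarrow>
    (\<forall>f\<in>Z. \<forall>g\<in>Z. T (f + g) = T f + T g) \<and>
    (\<forall>c. \<forall>f\<in>Z. T (scale_bcontfun c f) = scale_bcontfun c (T f))"

definition opnorm_on_le ::
    "'a::real_normed_vector set \<Rightarrow> ('a \<Rightarrow> 'b::real_normed_vector) \<Rightarrow> real \<Rightarrow> bool"
  where "opnorm_on_le Z T c \<longleftrightarrow> 0 \<le> c \<and> (\<forall>z\<in>Z. norm (T z) \<le> c * norm z)"

text \<open>
  The restriction of \<open>f\<close> to \<open>D\<close> is represented by its extension by \<open>0\<close>, a bounded function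
  on the point set of \<open>'k\<close>. Such functions form the normed space \<open>'k discrete \<Rightarrow>\<^sub>C 's\<close>, because all
  functions on a discrete space are continuous; the norm there is the uniform norm on \<open>D\<close>, see
  \<open>norm_restr\<close> below.
\<close>

definition restr ::
    "'k set \<Rightarrow> ('k::topological_space \<Rightarrow>\<^sub>C 's::real_normed_field) \<Rightarrow> ('k discrete \<Rightarrow>\<^sub>C 's)"
  where "restr D f =
    Bcontfun (\<lambda>x. if of_discrete x \<in> D then apply_bcontfun f (of_discrete x) else 0)"

lemma apply_restr:
  "apply_bcontfun (restr D f) x =
    (if of_discrete x \<in> D then apply_bcontfun f (of_discrete x) else 0)"
proof -
  have "(\<lambda>x. if of_discrete x \<in> D then apply_bcontfun f (of_discrete x) else 0) \<in> bcontfun"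
    by (rule bcontfun_normI[where b = "norm f"])
      (auto simp: continuous_on_open_vimage open_discrete norm_bounded)
  then show ?thesis
    by (simp add: restr_def Bcontfun_inverse)
qed

lemma restr_eq_iff:
  "restr D f = restr D g \<longleftrightarrow> (\<forall>x\<in>D. apply_bcontfun f x = apply_bcontfun g x)"
proof
  assume eq: "restr D f = restr D g"
  show "\<forall>x\<in>D. apply_bcontfun f x = apply_bcontfun g x"
  proof
    fix x assume "x \<in> D"
    then show "apply_bcontfun f x = apply_bcontfun g x"
      using arg_cong[OF eq, of "\<lambda>h. apply_bcontfun h (discrete x)"]
      by (simp add: apply_restr discrete_inverse)
  qed
qed (auto intro!: bcontfun_eqI simp: apply_restr)

lemma norm_restr:
  "norm (restr D f) = (if D = {} then 0 else SUP x\<in>D. norm (apply_bcontfun f x))"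
proof (cases "D = {}")
  case True
  then have "restr D f = 0" by (auto intro!: bcontfun_eqI simp: apply_restr)
  with True show ?thesis by simp
next
  case False
  have bdd: "bdd_above ((\<lambda>x. norm (apply_bcontfun f x)) ` D)"
    by (auto intro!: bdd_aboveI[where M = "norm f"] norm_bounded)
  have "norm (restr D f) \<le> (SUP x\<in>D. norm (apply_bcontfun f x))"
  proof (rule norm_bound)
    fix x
    obtain d where "d \<in> D" using False by blast
    then have "0 \<le> (SUP x\<in>D. norm (apply_bcontfun f x))"
      by (rule cSUP_upper2[OF bdd]) simp
    then show "norm (apply_bcontfun (restr D f) x) \<le> (SUP x\<in>D. norm (apply_bcontfun f x))"
      by (auto simp: apply_restr intro: cSUP_upper[OF _ bdd])
  qed
  moreover have "(SUP x\<in>D. norm (apply_bcontfun f x)) \<le> norm (restr D f)"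
  proof (rule cSUP_least[OF False])
    fix x assume "x \<in> D"
    then show "norm (apply_bcontfun f x) \<le> norm (restr D f)"
      using norm_bounded[of "restr D f" "discrete x"]
      by (simp add: apply_restr discrete_inverse)
  qed
  ultimately show ?thesis using False by simp
qed

definition bounded_extension_property ::
    "'k set \<Rightarrow> ('k::topological_space \<Rightarrow>\<^sub>C 's::real_normed_field) set \<Rightarrow> bool"
  where "bounded_extension_property D X \<longleftrightarrow>
    (\<exists>C::real. \<forall>f \<in> restr D ` X. \<forall>\<epsilon>>0. \<forall>U. open U \<and> D \<subseteq> U \<longrightarrow>
      (\<exists>F\<in>X. restr D F = f \<and> norm F \<le> C * norm f \<and>
        (\<forall>x. x \<notin> U \<longrightarrow> norm (apply_bcontfun F x) \<le> \<epsilon>)))"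

text \<open>
  Only the values of \<open>S\<close> on \<open>Z\<close> matter. The definition is meant for a complete subspace \<open>Z\<close> and
  a closed subspace \<open>Y\<close> of \<open>Z\<close>; the bounded extension property guarantees this for spaces of
  restrictions.
\<close>

definition pair_BAP ::
    "real \<Rightarrow> ('a::topological_space \<Rightarrow>\<^sub>C 's::real_normed_field) set \<Rightarrow> ('a \<Rightarrow>\<^sub>C 's) set \<Rightarrow> bool"
  where "pair_BAP l Z Y \<longleftrightarrow>
    (\<forall>\<epsilon>>0. \<forall>A. compact A \<and> A \<subseteq> Z \<longrightarrow>
      (\<exists>S. linear_map_on Z S \<and> S ` Z \<subseteq> Z \<and>
        (\<exists>B. finite B \<and> S ` Z \<subseteq> module.span scale_bcontfun B) \<and>
        opnorm_on_le Z S l \<and> (\<forall>z\<in>A. norm (S z - z) \<le> \<epsilon>) \<and> S ` Y \<subseteq> Y))"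

end

theory Submission
  imports Defs
begin

text \<open>
  Write \<open>E\<close> and \<open>Y\<close> for the spaces of restrictions of \<open>X1\<close> and \<open>X2\<close>. The approximation property
  gives finite-rank operators \<open>S n\<close> on \<open>E\<close> of norm at most \<open>l\<close> that preserve \<open>Y\<close> and converge to the
  identity on a dense sequence. The operator \<open>T\<close> is the strong limit of linear liftings \<open>L n\<close> of the
  \<open>S n\<close>, that is, of maps into \<open>X1\<close> with \<open>restr D (L n f) = S n f\<close> which send \<open>Y\<close> into \<open>X2\<close>. All the
  work goes into keeping the norms of the \<open>L n\<close> close to \<open>l\<close> while making consecutive liftings close
  to each other.

  On a finite-dimensional subspace \<open>G\<close> of \<open>E\<close>, extending the members of a basis of \<open>G\<close> adapted to
  \<open>G \<inter> Y\<close> gives linear liftings of the inclusion that are as small as desired off any given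
  neighbourhood of \<open>D\<close> (\<open>localized_lifts_finite_dim\<close>). Their norms share a bound \<open>C\<close>, which may be
  large because it depends on the basis. It is brought down by averaging over shrinking
  neighbourhoods (\<open>averaged_lift\<close>). If a map has norm at most \<open>l\<close> when restricted to \<open>D\<close> then, being
  of finite rank, it has norm at most \<open>l + e\<close> on a whole neighbourhood of \<open>D\<close>; choose the next lifting
  to be tiny off that neighbourhood, and so on. A point is then bad for at most one of the
  \<open>n\<close> liftings chosen, so that \<open>C\<close> enters the norm of their average only through a term of order
  \<open>C / n\<close>.

  To pass from \<open>L\<close>, which lifts \<open>S\<close> with norm at most \<open>l + e\<close>, to a lifting of \<open>S'\<close>, the average is
  taken of maps \<open>(1 - e) L + u (S' - (1 - e) S)\<close> (\<open>next_lift\<close>). The factor \<open>1 - e\<close> brings the norm of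
  the old lifting back to \<open>l\<close>, so that the errors do not accumulate: the norm of the new lifting is at
  most \<open>l + e'\<close> with \<open>e'\<close> as small as desired, and the limit has norm at most \<open>l\<close>. A separate
  application of the averaging gives \<open>u\<close> norm at most \<open>2\<close> independently of \<open>G\<close>, hence the step from \<open>L\<close>
  to the new lifting is controlled at \<open>f\<close> by \<open>e\<close> and the norm of \<open>S' f - S f\<close>. With \<open>e = (1/2) ^ n\<close> the
  sequence of liftings converges on the dense sequence, and therefore on all of \<open>E\<close>.
\<close>

section \<open>Coordinates in finite-dimensional spaces of bounded continuous functions\<close>

interpretation bc: vector_space
  "scale_bcontfun :: 's::real_normed_field \<Rightarrow> ('a::topological_space \<Rightarrow>\<^sub>C 's) \<Rightarrow> ('a \<Rightarrow>\<^sub>C 's)"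
  by (rule vector_space_scale_bcontfun)

lemma scale_bcontfun_of_real: "scale_bcontfun (of_real r) f = r *\<^sub>R f"
  by (rule bcontfun_eqI) (simp add: scaleR_conv_of_real)

lemma norm_scale_bcontfun:
  fixes f :: "'a::topological_space \<Rightarrow>\<^sub>C 's::real_normed_field"
  shows "norm (scale_bcontfun c f) = norm c * norm f"
proof (cases "c = 0")
  case False
  have le: "norm (scale_bcontfun a g) \<le> norm a * norm g" for a :: 's and g :: "'a \<Rightarrow>\<^sub>C 's"
    by (rule norm_bound) (simp add: norm_mult mult_left_mono norm_bounded)
  have "norm c * norm f = norm c * norm (scale_bcontfun (inverse c) (scale_bcontfun c f))"
    using False by simp
  also have "\<dots> \<le> norm c * (norm (inverse c) * norm (scale_bcontfun c f))"
    by (intro mult_left_mono le) simp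
  also have "\<dots> = norm (scale_bcontfun c f)"
    using False by (simp add: norm_inverse)
  finally show ?thesis using le[of c f] by simp
qed simp

lemma apply_sum_bcontfun:
  fixes F :: "'i \<Rightarrow> ('a::topological_space \<Rightarrow>\<^sub>C 's::real_normed_vector)"
  shows "apply_bcontfun (\<Sum>i\<in>I. F i) x = (\<Sum>i\<in>I. apply_bcontfun (F i) x)"
  by (induction I rule: infinite_finite_induct) auto

lemma subspace_scaleR:
  assumes "bc.subspace X" "f \<in> X"
  shows "r *\<^sub>R f \<in> X"
  using bc.subspace_scale[OF assms, of "of_real r"] by (simp add: scale_bcontfun_of_real)

text \<open>
  Dividing by \<open>a\<close> turns \<open>h + a b\<close> into a difference of \<open>b\<close> and a member of the span, whose norm is at
  least the distance. This is what bounds the coefficient of a basis vector.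
\<close>

lemma norm_le_dist_span:
  fixes b :: "'a::topological_space \<Rightarrow>\<^sub>C 's::real_normed_field"
  assumes "h \<in> bc.span B"
  shows "norm a * infdist b (bc.span B) \<le> norm (h + scale_bcontfun a b)"
proof (cases "a = 0")
  case False
  have "scale_bcontfun (- inverse a) h \<in> bc.span B"
    using assms by (rule bc.span_scale)
  then have "infdist b (bc.span B) \<le> dist b (scale_bcontfun (- inverse a) h)"
    by (rule infdist_le)
  also have "\<dots> = norm (scale_bcontfun (inverse a) (h + scale_bcontfun a b))"
    using False by (simp add: dist_norm bc.scale_right_distrib add.commute)
  also have "\<dots> = inverse (norm a) * norm (h + scale_bcontfun a b)"
    by (simp add: norm_scale_bcontfun norm_inverse)
  finally show ?thesis using False by (simp add: field_simps)
qed simp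

text \<open>
  Adding one vector \<open>b\<close> at a time: when \<open>b\<close> has positive distance from the closed span of the others,
  the coefficients of \<open>b\<close> along a convergent sequence form a Cauchy sequence of scalars.
\<close>

lemma closed_span_finite:
  fixes B :: "('a::topological_space \<Rightarrow>\<^sub>C 's::{real_normed_field, banach}) set"
  assumes "finite B"
  shows "closed (bc.span B)"
  using assms
proof (induction B)
  case empty
  show ?case by simp
next
  case (insert b B)
  show ?case
  proof (cases "b \<in> bc.span B")
    case True
    then show ?thesis using insert.IH by (simp add: bc.span_redundant)
  next
    case False
    define \<delta> where "\<delta> = infdist b (bc.span B)"
    have "\<delta> > 0"
      unfolding \<delta>_def
      by (rule infdist_pos_not_in_closed[OF insert.IH _ False]) (use bc.span_zero in blast)
    show ?thesis
      unfolding closed_sequential_limits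
    proof (intro allI impI, elim conjE)
      fix g l
      assume "\<forall>n. g n \<in> bc.span (insert b B)" and lim: "g \<longlonglongrightarrow> l"
      then have "\<forall>n. \<exists>a. g n - scale_bcontfun a b \<in> bc.span B"
        by (simp add: bc.span_breakdown_eq)
      then obtain a where a: "\<And>n. g n - scale_bcontfun (a n) b \<in> bc.span B"
        by metis
      have *: "norm (a m - a n) * \<delta> \<le> norm (g m - g n)" for m n
      proof -
        have "(g m - scale_bcontfun (a m) b) - (g n - scale_bcontfun (a n) b) \<in> bc.span B"
          by (rule bc.span_diff[OF a a])
        from norm_le_dist_span[OF this, of "a m - a n" b] show ?thesis
          by (simp add: \<delta>_def bc.scale_left_diff_distrib)
      qed
      have "Cauchy a"
      proof (rule CauchyI)
        fix e :: real assume "0 < e"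
        then have "0 < e * \<delta>" using \<open>\<delta> > 0\<close> by simp
        with LIMSEQ_imp_Cauchy[OF lim] obtain M
          where M: "\<And>m n. m \<ge> M \<Longrightarrow> n \<ge> M \<Longrightarrow> norm (g m - g n) < e * \<delta>"
          using CauchyD by blast
        show "\<exists>M. \<forall>m\<ge>M. \<forall>n\<ge>M. norm (a m - a n) < e"
          using le_less_trans[OF * M] \<open>\<delta> > 0\<close> by auto
      qed
      then obtain a' where a': "a \<longlonglongrightarrow> a'"
        by (auto simp: Cauchy_convergent_iff convergent_def)
      have "(\<lambda>n. scale_bcontfun (a n - a') b) \<longlonglongrightarrow> 0"
      proof (rule tendsto_norm_zero_cancel)
        have "(\<lambda>n. norm (a n - a') * norm b) \<longlonglongrightarrow> 0"
          using tendsto_mult_left_zero[OF tendsto_norm_zero[OF LIM_zero[OF a']]] .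
        then show "(\<lambda>n. norm (scale_bcontfun (a n - a') b)) \<longlonglongrightarrow> 0"
          by (simp add: norm_scale_bcontfun)
      qed
      from tendsto_add[OF this tendsto_const[of "scale_bcontfun a' b"]]
      have "(\<lambda>n. scale_bcontfun (a n) b) \<longlonglongrightarrow> scale_bcontfun a' b"
        by (simp add: bc.scale_left_diff_distrib)
      with lim have "(\<lambda>n. g n - scale_bcontfun (a n) b) \<longlonglongrightarrow> l - scale_bcontfun a' b"
        by (intro tendsto_diff)
      then have "l - scale_bcontfun a' b \<in> bc.span B"
        using closed_sequentially[OF insert.IH a] by simp
      then show "l \<in> bc.span (insert b B)"
        by (auto simp: bc.span_breakdown_eq)
    qed
  qed
qed

text \<open>
  Each basis vector has positive distance from the closed span of the others, and the inverse of that
  distance bounds the corresponding coordinate functional.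
\<close>

lemma bounded_coordinates:
  fixes B :: "('a::topological_space \<Rightarrow>\<^sub>C 's::{real_normed_field, banach}) set"
  assumes "finite B" "bc.independent B"
  obtains c where "c > 0" "\<And>g b. g \<in> bc.span B \<Longrightarrow> norm (bc.representation B g b) \<le> c * norm g"
proof -
  define \<delta> where "\<delta> b = infdist b (bc.span (B - {b}))" for b
  have \<delta>: "\<delta> b > 0" if "b \<in> B" for b
  proof -
    have "b \<notin> bc.span (B - {b})" using assms(2) that unfolding bc.dependent_def by blast
    moreover have "closed (bc.span (B - {b}))" using assms(1) by (intro closed_span_finite) simp
    moreover have "bc.span (B - {b}) \<noteq> {}" using bc.span_zero by blast
    ultimately show ?thesis
      unfolding \<delta>_def by (intro infdist_pos_not_in_closed)
  qed
  define c where "c = 1 + (\<Sum>b\<in>B. inverse (\<delta> b))"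
  have nn: "(\<Sum>b\<in>B. inverse (\<delta> b)) \<ge> 0"
    using \<delta> by (intro sum_nonneg) (simp add: less_imp_le)
  have "norm (bc.representation B g b) \<le> c * norm g" if g: "g \<in> bc.span B" for g b
  proof (cases "b \<in> B")
    case True
    let ?r = "bc.representation B g"
    let ?h = "\<Sum>b'\<in>B - {b}. scale_bcontfun (?r b') b'"
    have "(\<Sum>b'\<in>B. scale_bcontfun (?r b') b') = g"
      using assms g by (intro bc.sum_representation_eq) auto
    then have eq: "?h + scale_bcontfun (?r b) b = g"
      using sum.remove[OF assms(1) True, of "\<lambda>b'. scale_bcontfun (?r b') b'"] by (simp add: add.commute)
    have "?h \<in> bc.span (B - {b})"
      by (intro bc.span_sum bc.span_scale bc.span_base)
    from norm_le_dist_span[OF this, of "?r b" b]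
    have "norm (?r b) * \<delta> b \<le> norm g" unfolding eq \<delta>_def .
    then have "norm (?r b) \<le> inverse (\<delta> b) * norm g"
      using \<delta>[OF True] by (simp add: field_simps)
    also have "inverse (\<delta> b) \<le> c"
    proof -
      have "inverse (\<delta> b) \<le> (\<Sum>b\<in>B. inverse (\<delta> b))"
        using assms(1) True \<delta> by (intro member_le_sum) (auto simp: less_imp_le)
      then show ?thesis by (simp add: c_def)
    qed
    finally show ?thesis by (simp add: mult_right_mono)
  next
    case False
    then have "bc.representation B g b = 0" using bc.representation_ne_zero[of B g b] by auto
    then show ?thesis using nn by (simp add: c_def)
  qed
  moreover have "c > 0" using nn by (simp add: c_def)
  ultimately show ?thesis using that by blast
qed

section \<open>Maps that are equicontinuous on the unit ball\<close>

text \<open>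
  The image under \<open>w\<close> of the unit ball of \<open>Z\<close> is an equicontinuous family of functions. Bounded maps
  of finite rank have this property, and it is the only consequence of finite rank that the averaging
  argument uses. It passes to compositions with bounded maps and to linear combinations, which
  spares any bookkeeping of bases.
\<close>

definition equicontinuous_map_on ::
    "'z::real_normed_vector set \<Rightarrow> ('z \<Rightarrow> ('k::topological_space \<Rightarrow>\<^sub>C 's::real_normed_vector)) \<Rightarrow> bool"
  where "equicontinuous_map_on Z w \<longleftrightarrow>
    (\<forall>x. \<forall>e>0. \<exists>N. open N \<and> x \<in> N \<and>
      (\<forall>y\<in>N. \<forall>f\<in>Z. norm (apply_bcontfun (w f) y - apply_bcontfun (w f) x) \<le> e * norm f))"

lemma equicontinuous_map_onE:
  assumes "equicontinuous_map_on Z w" "e > 0"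
  obtains N where "open N" "x \<in> N"
    "\<And>y f. y \<in> N \<Longrightarrow> f \<in> Z \<Longrightarrow> norm (apply_bcontfun (w f) y - apply_bcontfun (w f) x) \<le> e * norm f"
  using assms unfolding equicontinuous_map_on_def by meson

lemma equicontinuous_map_on_lincomb:
  fixes u v :: "'z::real_normed_vector \<Rightarrow> ('k::topological_space \<Rightarrow>\<^sub>C 's::real_normed_vector)"
  assumes "equicontinuous_map_on Z u" "equicontinuous_map_on Z v"
  shows "equicontinuous_map_on Z (\<lambda>f. r *\<^sub>R u f + s *\<^sub>R v f)"
  unfolding equicontinuous_map_on_def
proof (intro allI impI)
  fix x :: 'k and e :: real
  assume "e > 0"
  define d where "d = e / (\<bar>r\<bar> + \<bar>s\<bar> + 1)"
  have "d > 0" and d: "(\<bar>r\<bar> + \<bar>s\<bar>) * d \<le> e"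
    using \<open>e > 0\<close> by (auto simp: d_def field_simps add_nonneg_pos)
  obtain M where M: "open M" "x \<in> M"
    "\<And>y f. y \<in> M \<Longrightarrow> f \<in> Z \<Longrightarrow> norm (apply_bcontfun (u f) y - apply_bcontfun (u f) x) \<le> d * norm f"
    using equicontinuous_map_onE[OF assms(1) \<open>d > 0\<close>] by blast
  obtain N where N: "open N" "x \<in> N"
    "\<And>y f. y \<in> N \<Longrightarrow> f \<in> Z \<Longrightarrow> norm (apply_bcontfun (v f) y - apply_bcontfun (v f) x) \<le> d * norm f"
    using equicontinuous_map_onE[OF assms(2) \<open>d > 0\<close>] by blast
  have "norm (apply_bcontfun (r *\<^sub>R u f + s *\<^sub>R v f) y - apply_bcontfun (r *\<^sub>R u f + s *\<^sub>R v f) x)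
      \<le> e * norm f" if "y \<in> M \<inter> N" "f \<in> Z" for y f
  proof -
    have "apply_bcontfun (r *\<^sub>R u f + s *\<^sub>R v f) y - apply_bcontfun (r *\<^sub>R u f + s *\<^sub>R v f) x
        = r *\<^sub>R (apply_bcontfun (u f) y - apply_bcontfun (u f) x)
          + s *\<^sub>R (apply_bcontfun (v f) y - apply_bcontfun (v f) x)"
      by (simp add: algebra_simps)
    also have "norm \<dots> \<le> \<bar>r\<bar> * (d * norm f) + \<bar>s\<bar> * (d * norm f)"
      using that M(3)[of y f] N(3)[of y f]
      by (intro norm_triangle_le add_mono) (auto simp: mult_left_mono)
    also have "\<dots> = ((\<bar>r\<bar> + \<bar>s\<bar>) * d) * norm f" by (simp add: algebra_simps)
    also have "\<dots> \<le> e * norm f" by (intro mult_right_mono d) simp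
    finally show ?thesis .
  qed
  then show "\<exists>N. open N \<and> x \<in> N \<and> (\<forall>y\<in>N. \<forall>f\<in>Z.
      norm (apply_bcontfun (r *\<^sub>R u f + s *\<^sub>R v f) y - apply_bcontfun (r *\<^sub>R u f + s *\<^sub>R v f) x)
        \<le> e * norm f)"
    using M(1,2) N(1,2) by (intro exI[of _ "M \<inter> N"]) auto
qed

lemma equicontinuous_map_on_compose:
  fixes u :: "'z::real_normed_vector \<Rightarrow> ('k::topological_space \<Rightarrow>\<^sub>C 's::real_normed_vector)"
    and V :: "'y::real_normed_vector \<Rightarrow> 'z"
  assumes "equicontinuous_map_on G u" "V ` Z \<subseteq> G" "opnorm_on_le Z V M"
  shows "equicontinuous_map_on Z (\<lambda>f. u (V f))"
  unfolding equicontinuous_map_on_def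
proof (intro allI impI)
  fix x :: 'k and e :: real
  assume "e > 0"
  have M: "0 \<le> M" "\<And>f. f \<in> Z \<Longrightarrow> norm (V f) \<le> M * norm f"
    using assms(3) by (auto simp: opnorm_on_le_def)
  define d where "d = e / (M + 1)"
  have "d > 0" and d: "d * M \<le> e"
    using \<open>e > 0\<close> M(1) by (auto simp: d_def field_simps)
  obtain N where N: "open N" "x \<in> N"
    "\<And>y g. y \<in> N \<Longrightarrow> g \<in> G \<Longrightarrow> norm (apply_bcontfun (u g) y - apply_bcontfun (u g) x) \<le> d * norm g"
    using equicontinuous_map_onE[OF assms(1) \<open>d > 0\<close>] by blast
  have "norm (apply_bcontfun (u (V f)) y - apply_bcontfun (u (V f)) x) \<le> e * norm f"
    if "y \<in> N" "f \<in> Z" for y f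
  proof -
    have "norm (apply_bcontfun (u (V f)) y - apply_bcontfun (u (V f)) x) \<le> d * norm (V f)"
      using that assms(2) by (intro N(3)) auto
    also have "\<dots> \<le> d * (M * norm f)"
      using \<open>d > 0\<close> M(2)[OF that(2)] by (intro mult_left_mono) auto
    also have "\<dots> = (d * M) * norm f" by simp
    also have "\<dots> \<le> e * norm f" by (intro mult_right_mono d) simp
    finally show ?thesis .
  qed
  then show "\<exists>N. open N \<and> x \<in> N \<and> (\<forall>y\<in>N. \<forall>f\<in>Z.
      norm (apply_bcontfun (u (V f)) y - apply_bcontfun (u (V f)) x) \<le> e * norm f)"
    using N(1,2) by blast
qed

section \<open>Linear liftings of operators on spaces of restrictions\<close>

lemma restr_add: "restr D (f + g) = restr D f + restr D g"
  by (rule bcontfun_eqI) (simp add: apply_restr)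

lemma restr_diff: "restr D (f - g) = restr D f - restr D g"
  by (rule bcontfun_eqI) (simp add: apply_restr)

lemma restr_zero [simp]: "restr D 0 = 0"
  by (rule bcontfun_eqI) (simp add: apply_restr)

lemma restr_scale: "restr D (scale_bcontfun c f) = scale_bcontfun c (restr D f)"
  by (rule bcontfun_eqI) (simp add: apply_restr)

lemma restr_scaleR: "restr D (r *\<^sub>R f) = r *\<^sub>R restr D f"
  by (rule bcontfun_eqI) (simp add: apply_restr)

lemma restr_sum: "restr D (\<Sum>i\<in>I. F i) = (\<Sum>i\<in>I. restr D (F i))"
  by (induction I rule: infinite_finite_induct) (auto simp: restr_add)

lemma norm_restr_le: "norm (restr D f) \<le> norm f"
  by (rule norm_bound) (simp add: apply_restr norm_bounded)

lemma subspace_restr: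
  assumes "bc.subspace X"
  shows "bc.subspace (restr D ` X)"
proof (rule bc.subspaceI)
  show "0 \<in> restr D ` X"
    using bc.subspace_0[OF assms] by (intro image_eqI[of _ _ 0]) simp_all
next
  fix f g assume "f \<in> restr D ` X" "g \<in> restr D ` X"
  then show "f + g \<in> restr D ` X"
    using bc.subspace_add[OF assms] by (auto simp: restr_add[symmetric])
next
  fix c f assume "f \<in> restr D ` X"
  then show "scale_bcontfun c f \<in> restr D ` X"
    using bc.subspace_scale[OF assms] by (auto simp: restr_scale[symmetric])
qed

lemma scale_bcontfun_scaleR: "scale_bcontfun c (r *\<^sub>R f) = r *\<^sub>R scale_bcontfun c f"
  by (rule bcontfun_eqI) simp

lemma linear_map_on_lincomb:
  fixes u v :: "('a::topological_space \<Rightarrow>\<^sub>C 's::real_normed_field) \<Rightarrow> ('b::topological_space \<Rightarrow>\<^sub>C 's)"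
  assumes "linear_map_on Z u" "linear_map_on Z v"
  shows "linear_map_on Z (\<lambda>f. r *\<^sub>R u f + s *\<^sub>R v f)"
  using assms unfolding linear_map_on_def
  by (simp add: scaleR_right_distrib bc.scale_right_distrib scale_bcontfun_scaleR)

lemma linear_map_on_compose:
  assumes "linear_map_on G u" "linear_map_on Z V" "V ` Z \<subseteq> G"
  shows "linear_map_on Z (\<lambda>f. u (V f))"
  using assms unfolding linear_map_on_def by (auto simp: image_subset_iff)

text \<open>
  The operator \<open>S\<close> is a parameter, so that the same notion covers liftings of the inclusion of a
  finite-dimensional space (\<open>S\<close> the identity) and of the approximating operators.
\<close>

definition lifting ::
    "'k set \<Rightarrow> ('k::topological_space \<Rightarrow>\<^sub>C 's::real_normed_field) set \<Rightarrow> ('k \<Rightarrow>\<^sub>C 's) set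
      \<Rightarrow> ('k discrete \<Rightarrow>\<^sub>C 's) set \<Rightarrow> ('k discrete \<Rightarrow>\<^sub>C 's) set
      \<Rightarrow> (('k discrete \<Rightarrow>\<^sub>C 's) \<Rightarrow> ('k discrete \<Rightarrow>\<^sub>C 's))
      \<Rightarrow> (('k discrete \<Rightarrow>\<^sub>C 's) \<Rightarrow> ('k \<Rightarrow>\<^sub>C 's)) \<Rightarrow> bool"
  where "lifting D X1 X2 Z Y S L \<longleftrightarrow>
    linear_map_on Z L \<and> equicontinuous_map_on Z L \<and>
    (\<forall>f\<in>Z. L f \<in> X1 \<and> restr D (L f) = S f) \<and> (\<forall>f\<in>Z \<inter> Y. L f \<in> X2)"

lemma lifting_lincomb:
  assumes "bc.subspace X1" "bc.subspace X2"
    and "lifting D X1 X2 Z Y S u" "lifting D X1 X2 Z Y S' v"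
  shows "lifting D X1 X2 Z Y (\<lambda>f. r *\<^sub>R S f + s *\<^sub>R S' f) (\<lambda>f. r *\<^sub>R u f + s *\<^sub>R v f)"
  using assms unfolding lifting_def
  by (auto intro!: linear_map_on_lincomb equicontinuous_map_on_lincomb bc.subspace_add
      subspace_scaleR simp: restr_add restr_scaleR)

lemma lifting_compose:
  assumes "lifting D X1 X2 G Y (\<lambda>g. g) u"
    and "linear_map_on Z V" "V ` Z \<subseteq> G" "V ` (Z \<inter> Y) \<subseteq> Y" "opnorm_on_le Z V M"
  shows "lifting D X1 X2 Z Y V (\<lambda>f. u (V f))"
  using assms linear_map_on_compose[of G u Z V] equicontinuous_map_on_compose[of G u V Z M]
  unfolding lifting_def by (auto simp: image_subset_iff)

text \<open>
  The bound \<open>C\<close> has to be independent of the neighbourhood \<open>U\<close> and of \<open>e\<close>; this uniformity is what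
  averaging needs.
\<close>

definition localized_lifts ::
    "'k set \<Rightarrow> ('k::topological_space \<Rightarrow>\<^sub>C 's::real_normed_field) set \<Rightarrow> ('k \<Rightarrow>\<^sub>C 's) set
      \<Rightarrow> ('k discrete \<Rightarrow>\<^sub>C 's) set \<Rightarrow> ('k discrete \<Rightarrow>\<^sub>C 's) set \<Rightarrow> real \<Rightarrow> bool"
  where "localized_lifts D X1 X2 G Y C \<longleftrightarrow>
    (\<forall>U. \<forall>e>0. open U \<and> D \<subseteq> U \<longrightarrow>
      (\<exists>u. lifting D X1 X2 G Y (\<lambda>g. g) u \<and> opnorm_on_le G u C \<and>
        (\<forall>g\<in>G. \<forall>x. x \<notin> U \<longrightarrow> norm (apply_bcontfun (u g) x) \<le> e * norm g)))"

lemma bounded_extension_propertyE: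
  assumes "bounded_extension_property D X"
  obtains C where "C \<ge> 0"
    "\<And>f \<epsilon> U. f \<in> restr D ` X \<Longrightarrow> \<epsilon> > 0 \<Longrightarrow> open U \<Longrightarrow> D \<subseteq> U \<Longrightarrow>
      \<exists>F\<in>X. restr D F = f \<and> norm F \<le> C * norm f \<and>
        (\<forall>x. x \<notin> U \<longrightarrow> norm (apply_bcontfun F x) \<le> \<epsilon>)"
proof -
  from assms[unfolded bounded_extension_property_def]
  obtain C where C: "\<forall>f \<in> restr D ` X. \<forall>\<epsilon>>0. \<forall>U. open U \<and> D \<subseteq> U \<longrightarrow>
      (\<exists>F\<in>X. restr D F = f \<and> norm F \<le> C * norm f \<and>
        (\<forall>x. x \<notin> U \<longrightarrow> norm (apply_bcontfun F x) \<le> \<epsilon>))" ..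
  have "\<exists>F\<in>X. restr D F = f \<and> norm F \<le> \<bar>C\<bar> * norm f \<and>
        (\<forall>x. x \<notin> U \<longrightarrow> norm (apply_bcontfun F x) \<le> \<epsilon>)"
    if f: "f \<in> restr D ` X" "\<epsilon> > 0" "open U" "D \<subseteq> U" for f \<epsilon> U
  proof -
    obtain F where F: "F \<in> X" "restr D F = f" "norm F \<le> C * norm f"
        "\<forall>x. x \<notin> U \<longrightarrow> norm (apply_bcontfun F x) \<le> \<epsilon>"
      using C[rule_format, of f \<epsilon> U] f by blast
    have "C * norm f \<le> \<bar>C\<bar> * norm f" by (intro mult_right_mono) auto
    with F show ?thesis by (intro bexI[of _ F]) auto
  qed
  with that[of "\<bar>C\<bar>"] show ?thesis by simp
qed

text \<open>
  Take a basis of \<open>G \<inter> restr D ` X2\<close>, extend it to a basis of \<open>G\<close>, and extend each basis vector from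
  \<open>D\<close> within \<open>X2\<close> or \<open>X1\<close> accordingly. Boundedness of the coordinates turns the bounds for the finitely
  many extensions into bounds for their linear combinations.
\<close>

lemma localized_lifts_finite_dim:
  fixes X1 X2 :: "('k::topological_space \<Rightarrow>\<^sub>C 's::{real_normed_field, banach}) set"
  assumes X1: "bc.subspace X1" and X2: "bc.subspace X2" and sub: "X2 \<subseteq> X1"
    and bep1: "bounded_extension_property D X1" and bep2: "bounded_extension_property D X2"
    and G: "bc.subspace G" "G \<subseteq> restr D ` X1" "finite B0" "G \<subseteq> bc.span B0"
  shows "\<exists>C. localized_lifts D X1 X2 G (restr D ` X2) C"
proof -
  define Y where "Y = restr D ` X2"
  obtain B2 where B2: "B2 \<subseteq> G \<inter> Y" "bc.independent B2" "G \<inter> Y \<subseteq> bc.span B2"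
    using bc.maximal_independent_subset .
  obtain B where B: "B2 \<subseteq> B" "B \<subseteq> G" "bc.independent B" "G \<subseteq> bc.span B"
    using bc.maximal_independent_subset_extend[of B2 G] B2 by blast
  have finB: "finite B"
    using bc.independent_span_bound[OF G(3) B(3)] B(2) G(4) by blast
  obtain c where c: "c > 0" "\<And>g b. g \<in> bc.span B \<Longrightarrow> norm (bc.representation B g b) \<le> c * norm g"
    using bounded_coordinates[OF finB B(3)] by blast
  obtain C1 where C1: "C1 \<ge> 0"
    "\<And>f \<epsilon> U. f \<in> restr D ` X1 \<Longrightarrow> \<epsilon> > 0 \<Longrightarrow> open U \<Longrightarrow> D \<subseteq> U \<Longrightarrow>
      \<exists>F\<in>X1. restr D F = f \<and> norm F \<le> C1 * norm f \<and>
        (\<forall>x. x \<notin> U \<longrightarrow> norm (apply_bcontfun F x) \<le> \<epsilon>)"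
    using bounded_extension_propertyE[OF bep1] by blast
  obtain C2 where C2: "C2 \<ge> 0"
    "\<And>f \<epsilon> U. f \<in> restr D ` X2 \<Longrightarrow> \<epsilon> > 0 \<Longrightarrow> open U \<Longrightarrow> D \<subseteq> U \<Longrightarrow>
      \<exists>F\<in>X2. restr D F = f \<and> norm F \<le> C2 * norm f \<and>
        (\<forall>x. x \<notin> U \<longrightarrow> norm (apply_bcontfun F x) \<le> \<epsilon>)"
    using bounded_extension_propertyE[OF bep2] by blast
  define C where "C = (\<Sum>b\<in>B. c * ((C1 + C2) * norm b))"
  have "C \<ge> 0" unfolding C_def using c C1(1) C2(1) by (intro sum_nonneg) auto
  \<comment> \<open>Smallness off \<open>U\<close> and equicontinuity both reduce to this estimate, with \<open>q b\<close> a value or a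
    difference of values of the extension of \<open>b\<close>. The summand \<open>1\<close> keeps the bound meaningful when the
    basis is empty.\<close>
  have comb: "norm (\<Sum>b\<in>B. bc.representation B g b * q b) \<le> e * norm g"
    if "g \<in> G" and q: "\<And>b. b \<in> B \<Longrightarrow> norm (q b) \<le> e / (c * (card B + 1))" and "e > 0"
    for g and q :: "'k discrete \<Rightarrow>\<^sub>C 's \<Rightarrow> 's" and e
  proof -
    have "norm (\<Sum>b\<in>B. bc.representation B g b * q b)
        \<le> (\<Sum>b\<in>B. (c * norm g) * (e / (c * (card B + 1))))"
    proof (rule sum_norm_le)
      fix b assume "b \<in> B"
      have "norm (bc.representation B g b) \<le> c * norm g" using \<open>g \<in> G\<close> B(4) by (intro c(2)) auto
      then show "norm (bc.representation B g b * q b) \<le> (c * norm g) * (e / (c * (card B + 1)))"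
        unfolding norm_mult using q[OF \<open>b \<in> B\<close>] c(1) by (intro mult_mono) auto
    qed
    also have "\<dots> = card B * (norm g * (c * (e / (c * (card B + 1)))))"
      by (simp add: mult_ac)
    also have "c * (e / (c * (card B + 1))) = e / (card B + 1)"
      using c(1) by simp
    also have "card B * (norm g * (e / (card B + 1))) = card B / (card B + 1) * (e * norm g)"
      by simp
    also have "\<dots> \<le> 1 * (e * norm g)"
      using \<open>e > 0\<close> by (intro mult_right_mono) auto
    finally show ?thesis by simp
  qed
  have "\<exists>u. lifting D X1 X2 G Y (\<lambda>g. g) u \<and> opnorm_on_le G u C \<and>
        (\<forall>g\<in>G. \<forall>x. x \<notin> U \<longrightarrow> norm (apply_bcontfun (u g) x) \<le> e * norm g)"
    if U: "open U" "D \<subseteq> U" and "e > 0" for U e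
  proof -
    define \<eta> where "\<eta> = e / (c * (card B + 1))"
    have "\<eta> > 0" using \<open>e > 0\<close> c(1) by (simp add: \<eta>_def)
    have ex: "\<exists>F. F \<in> X1 \<and> restr D F = b \<and> norm F \<le> (C1 + C2) * norm b \<and>
        (\<forall>x. x \<notin> U \<longrightarrow> norm (apply_bcontfun F x) \<le> \<eta>) \<and> (b \<in> B2 \<longrightarrow> F \<in> X2)" if "b \<in> B" for b
    proof (cases "b \<in> B2")
      case True
      then obtain F where "F \<in> X2" "restr D F = b" "norm F \<le> C2 * norm b"
          "\<forall>x. x \<notin> U \<longrightarrow> norm (apply_bcontfun F x) \<le> \<eta>"
        using C2(2)[OF _ \<open>\<eta> > 0\<close> U] B2(1) Y_def by blast
      moreover have "C2 * norm b \<le> (C1 + C2) * norm b" using C1(1) by (intro mult_right_mono) auto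
      ultimately show ?thesis using sub by (intro exI[of _ F]) auto
    next
      case False
      have "b \<in> restr D ` X1" using that B(2) G(2) by blast
      then obtain F where "F \<in> X1" "restr D F = b" "norm F \<le> C1 * norm b"
          "\<forall>x. x \<notin> U \<longrightarrow> norm (apply_bcontfun F x) \<le> \<eta>"
        using C1(2)[OF _ \<open>\<eta> > 0\<close> U] by blast
      moreover have "C1 * norm b \<le> (C1 + C2) * norm b" using C2(1) by (intro mult_right_mono) auto
      ultimately show ?thesis using False by (intro exI[of _ F]) auto
    qed
    have "\<exists>F. \<forall>b\<in>B. F b \<in> X1 \<and> restr D (F b) = b \<and> norm (F b) \<le> (C1 + C2) * norm b \<and>
        (\<forall>x. x \<notin> U \<longrightarrow> norm (apply_bcontfun (F b) x) \<le> \<eta>) \<and> (b \<in> B2 \<longrightarrow> F b \<in> X2)"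
      by (intro bchoice ballI ex)
    then obtain F where F0: "\<forall>b\<in>B. F b \<in> X1 \<and> restr D (F b) = b \<and>
        norm (F b) \<le> (C1 + C2) * norm b \<and>
        (\<forall>x. x \<notin> U \<longrightarrow> norm (apply_bcontfun (F b) x) \<le> \<eta>) \<and> (b \<in> B2 \<longrightarrow> F b \<in> X2)" ..
    have F: "F b \<in> X1" "restr D (F b) = b" "norm (F b) \<le> (C1 + C2) * norm b"
      "x \<notin> U \<Longrightarrow> norm (apply_bcontfun (F b) x) \<le> \<eta>" "b \<in> B2 \<Longrightarrow> F b \<in> X2"
      if "b \<in> B" for b x
      using bspec[OF F0 that] by simp_all
    define u where "u g = (\<Sum>b\<in>B. scale_bcontfun (bc.representation B g b) (F b))" for g
    have u_apply: "apply_bcontfun (u g) x = (\<Sum>b\<in>B. bc.representation B g b * apply_bcontfun (F b) x)"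
      for g x by (simp add: u_def apply_sum_bcontfun)
    have "linear_map_on G u"
      unfolding linear_map_on_def
    proof (intro conjI ballI allI)
      fix f g assume "f \<in> G" "g \<in> G"
      then show "u (f + g) = u f + u g"
        using B(4) by (simp add: u_def bc.representation_add[OF B(3)] subset_iff
            bc.scale_left_distrib sum.distrib)
    next
      fix a f assume "f \<in> G"
      then show "u (scale_bcontfun a f) = scale_bcontfun a (u f)"
        using B(4) by (simp add: u_def bc.representation_scale[OF B(3)] subset_iff
            bc.scale_sum_right)
    qed
    moreover have "equicontinuous_map_on G u"
      unfolding equicontinuous_map_on_def
    proof (intro allI impI)
      fix x :: 'k and e' :: real
      assume "e' > 0"
      define d where "d = e' / (c * (card B + 1))"
      have "d > 0" using \<open>e' > 0\<close> c(1) by (simp add: d_def)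
      define N where "N = (\<Inter>b\<in>B. {y. norm (apply_bcontfun (F b) y - apply_bcontfun (F b) x) < d})"
      have "open N"
        unfolding N_def using finB by (intro open_INT ballI open_Collect_less continuous_intros) auto
      moreover have "x \<in> N" using \<open>d > 0\<close> by (simp add: N_def)
      moreover have "norm (apply_bcontfun (u g) y - apply_bcontfun (u g) x) \<le> e' * norm g"
        if "y \<in> N" "g \<in> G" for y g
      proof -
        have "apply_bcontfun (u g) y - apply_bcontfun (u g) x = (\<Sum>b\<in>B. bc.representation B g b *
            (apply_bcontfun (F b) y - apply_bcontfun (F b) x))"
          by (simp add: u_apply sum_subtractf right_diff_distrib)
        then show ?thesis
          using that comb[OF that(2) _ \<open>e' > 0\<close>,
              of "\<lambda>b. apply_bcontfun (F b) y - apply_bcontfun (F b) x"]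
          by (auto simp: N_def d_def less_imp_le)
      qed
      ultimately show "\<exists>N. open N \<and> x \<in> N \<and> (\<forall>y\<in>N. \<forall>f\<in>G.
          norm (apply_bcontfun (u f) y - apply_bcontfun (u f) x) \<le> e' * norm f)"
        by blast
    qed
    moreover have "u g \<in> X1" for g
      unfolding u_def using F(1) by (intro bc.subspace_sum[OF X1] bc.subspace_scale[OF X1])
    moreover have "restr D (u g) = g" if "g \<in> G" for g
    proof -
      have "restr D (u g) = (\<Sum>b\<in>B. scale_bcontfun (bc.representation B g b) b)"
        unfolding u_def restr_sum using F(2) by (intro sum.cong) (auto simp: restr_scale)
      also have "\<dots> = g"
        using that B finB by (intro bc.sum_representation_eq) auto
      finally show ?thesis .
    qed
    moreover have "u g \<in> X2" if "g \<in> G \<inter> Y" for g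
    proof -
      \<comment> \<open>Only basis vectors from \<open>B2\<close> occur in \<open>g\<close>, and their extensions were taken in \<open>X2\<close>.\<close>
      have rep: "bc.representation B g = bc.representation B2 g"
        using that B2(3) by (intro bc.representation_extend B) auto
      have "scale_bcontfun (bc.representation B g b) (F b) \<in> X2" if "b \<in> B" for b
      proof (cases "b \<in> B2")
        case True
        then show ?thesis using F(5) that by (intro bc.subspace_scale[OF X2]) auto
      next
        case False
        then have "bc.representation B g b = 0"
          using bc.representation_ne_zero[of B2 g b] unfolding rep by auto
        then show ?thesis using bc.subspace_0[OF X2] by simp
      qed
      then show ?thesis unfolding u_def by (intro bc.subspace_sum[OF X2])
    qed
    ultimately have "lifting D X1 X2 G Y (\<lambda>g. g) u" by (simp add: lifting_def)
    moreover have "norm (u g) \<le> C * norm g" if "g \<in> G" for g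
    proof -
      have "norm (u g) \<le> (\<Sum>b\<in>B. (c * norm g) * ((C1 + C2) * norm b))"
        unfolding u_def using that B(4) c F(3)
        by (intro sum_norm_le) (auto simp: norm_scale_bcontfun intro!: mult_mono)
      also have "\<dots> = C * norm g"
        by (simp add: C_def sum_distrib_left sum_distrib_right mult_ac)
      finally show ?thesis .
    qed
    then have "opnorm_on_le G u C" using \<open>C \<ge> 0\<close> by (simp add: opnorm_on_le_def)
    moreover have "norm (apply_bcontfun (u g) x) \<le> e * norm g" if "g \<in> G" "x \<notin> U" for g x
      unfolding u_apply using F(4) that \<open>e > 0\<close> by (intro comb) (auto simp: \<eta>_def)
    ultimately show ?thesis by blast
  qed
  then show ?thesis unfolding localized_lifts_def Y_def by blast
qed

section \<open>Averaging over shrinking neighbourhoods\<close>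

text \<open>
  Equicontinuity supplies, around each point of \<open>D\<close>, a neighbourhood that serves all \<open>f\<close> at once.
\<close>

lemma interior_small_values:
  assumes w: "equicontinuous_map_on Z w" and "e > 0"
    and D: "\<And>f x. f \<in> Z \<Longrightarrow> x \<in> D \<Longrightarrow> norm (apply_bcontfun (w f) x) \<le> l * norm f"
  shows "D \<subseteq> interior {x. \<forall>f\<in>Z. norm (apply_bcontfun (w f) x) \<le> (l + e) * norm f}"
proof
  fix x assume x: "x \<in> D"
  obtain N where N: "open N" "x \<in> N"
    "\<And>y f. y \<in> N \<Longrightarrow> f \<in> Z \<Longrightarrow> norm (apply_bcontfun (w f) y - apply_bcontfun (w f) x) \<le> e * norm f"
    using equicontinuous_map_onE[OF w \<open>e > 0\<close>] by blast
  have "norm (apply_bcontfun (w f) y) \<le> (l + e) * norm f" if "y \<in> N" "f \<in> Z" for y f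
  proof -
    have "norm (apply_bcontfun (w f) y)
        \<le> norm (apply_bcontfun (w f) x) + norm (apply_bcontfun (w f) y - apply_bcontfun (w f) x)"
      by (rule norm_triangle_sub)
    also have "\<dots> \<le> l * norm f + e * norm f"
      using that x by (intro add_mono D N(3))
    finally show ?thesis by (simp add: distrib_right)
  qed
  then show "x \<in> interior {x. \<forall>f\<in>Z. norm (apply_bcontfun (w f) x) \<le> (l + e) * norm f}"
    using N(1,2) by (intro interiorI[of N]) auto
qed

text \<open>
  The norm of \<open>L f + u (V f)\<close> is at most \<open>l * norm f\<close> on \<open>D\<close> and nearly so wherever \<open>u\<close> is tiny, but in
  between only the crude bound \<open>K = l + C * M\<close> is available. Averaging liftings \<open>u\<close> whose regions in
  between are disjoint divides the excess by their number.
\<close>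

lemma averaged_lift:
  fixes X1 X2 :: "('k::topological_space \<Rightarrow>\<^sub>C 's::real_normed_field) set"
    and L :: "'z::real_normed_vector \<Rightarrow> ('k \<Rightarrow>\<^sub>C 's)"
  assumes X1: "bc.subspace X1" and X2: "bc.subspace X2"
    and loc: "localized_lifts D X1 X2 G Y C"
    and L: "equicontinuous_map_on Z L" "opnorm_on_le Z L l"
    and V: "V ` Z \<subseteq> G" "opnorm_on_le Z V M"
    and onD: "\<And>f. f \<in> Z \<Longrightarrow> norm (restr D (L f) + V f) \<le> l * norm f"
    and e: "e > 0" and U: "open U" "D \<subseteq> U" and d: "d > 0"
  shows "\<exists>u. lifting D X1 X2 G Y (\<lambda>g. g) u \<and> opnorm_on_le G u C \<and>
    (\<forall>g\<in>G. \<forall>x. x \<notin> U \<longrightarrow> norm (apply_bcontfun (u g) x) \<le> d * norm g) \<and>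
    opnorm_on_le Z (\<lambda>f. L f + u (V f)) (l + e)"
proof -
  have l: "0 \<le> l" "\<And>f. f \<in> Z \<Longrightarrow> norm (L f) \<le> l * norm f"
    using L(2) by (auto simp: opnorm_on_le_def)
  have M: "0 \<le> M" "\<And>f. f \<in> Z \<Longrightarrow> norm (V f) \<le> M * norm f"
    using V(2) by (auto simp: opnorm_on_le_def)
  have VG: "V f \<in> G" if "f \<in> Z" for f using V(1) that by blast
  obtain u0 :: "('k discrete \<Rightarrow>\<^sub>C 's) \<Rightarrow> ('k \<Rightarrow>\<^sub>C 's)" where "opnorm_on_le G u0 C"
    using loc U e unfolding localized_lifts_def by blast
  then have "0 \<le> C" by (simp add: opnorm_on_le_def)
  \<comment> \<open>Half of \<open>e\<close> absorbs the values off the neighbourhoods, the other half the term \<open>K / n\<close>. The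
    number \<open>\<eta>\<close> makes \<open>u (V f)\<close> at most \<open>e' * norm f\<close> there, as the norm of \<open>V f\<close> is at most
    \<open>M * norm f\<close>.\<close>
  define e' where "e' = e / 2"
  define \<eta> where "\<eta> = min d (e' / (M + 1))"
  define K where "K = l + C * M"
  have "e' > 0" using e by (simp add: e'_def)
  have "\<eta> > 0" "\<eta> \<le> d" using \<open>e' > 0\<close> M(1) d by (auto simp: \<eta>_def)
  have "K \<ge> 0" using l(1) M(1) \<open>0 \<le> C\<close> by (simp add: K_def)
  have \<eta>M: "\<eta> * M \<le> e'"
  proof -
    have "\<eta> * M \<le> e' / (M + 1) * M" unfolding \<eta>_def using M(1) by (intro mult_right_mono) auto
    also have "\<dots> \<le> e'" using M(1) \<open>e' > 0\<close> by (simp add: field_simps)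
    finally show ?thesis .
  qed
  define good where "good U u \<longleftrightarrow> lifting D X1 X2 G Y (\<lambda>g. g) u \<and> opnorm_on_le G u C \<and>
      (\<forall>g\<in>G. \<forall>x. x \<notin> U \<longrightarrow> norm (apply_bcontfun (u g) x) \<le> \<eta> * norm g)" for U u
  have good_ex: "\<exists>u. good U u" if "open U" "D \<subseteq> U" for U
    using loc that \<open>\<eta> > 0\<close> unfolding localized_lifts_def good_def by blast
  have outside: "norm (apply_bcontfun (L f + u (V f)) x) \<le> (l + e') * norm f"
    if "good U u" "f \<in> Z" "x \<notin> U" for U u f x
  proof -
    have "norm (apply_bcontfun (u (V f)) x) \<le> \<eta> * norm (V f)"
      using that VG unfolding good_def by blast
    also have "\<dots> \<le> \<eta> * (M * norm f)"
      using \<open>\<eta> > 0\<close> M(2)[OF that(2)] by (intro mult_left_mono) auto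
    also have "\<dots> = (\<eta> * M) * norm f" by simp
    also have "\<dots> \<le> e' * norm f" by (intro mult_right_mono \<eta>M) simp
    finally have "norm (apply_bcontfun (u (V f)) x) \<le> e' * norm f" .
    moreover have "norm (apply_bcontfun (L f) x) \<le> l * norm f"
      using norm_bounded[of "L f" x] l(2)[OF that(2)] by linarith
    ultimately show ?thesis
      by (simp add: distrib_right norm_triangle_le)
  qed
  have everywhere: "norm (apply_bcontfun (L f + u (V f)) x) \<le> K * norm f"
    if "good U u" "f \<in> Z" for U u f x
  proof -
    have "norm (u (V f)) \<le> C * norm (V f)"
      using that VG unfolding good_def opnorm_on_le_def by blast
    also have "\<dots> \<le> C * (M * norm f)"
      using \<open>0 \<le> C\<close> M(2)[OF that(2)] by (intro mult_left_mono) auto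
    finally have "norm (L f + u (V f)) \<le> l * norm f + C * (M * norm f)"
      using l(2)[OF that(2)] by (intro norm_triangle_le) linarith
    also have "\<dots> = K * norm f" by (simp add: K_def algebra_simps)
    finally show ?thesis using norm_bounded[of "L f + u (V f)" x] by linarith
  qed
  \<comment> \<open>An average of \<open>n + 1\<close> liftings is built from one lifting \<open>u\<close> for \<open>U\<close> and an average \<open>v\<close> of \<open>n\<close>
    liftings for a smaller neighbourhood \<open>U'\<close> on which \<open>u\<close> is harmless. Quantifying over \<open>U\<close> makes the
    induction possible, and \<open>good U\<close> is preserved because \<open>v\<close> is small off \<open>U'\<close>, hence off \<open>U\<close>.\<close>
  have average: "\<exists>u. good U u \<and> (\<forall>f\<in>Z. \<forall>x. norm (apply_bcontfun (L f + u (V f)) x)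
      \<le> (l + e' + K / real (n + 1)) * norm f)" if "open U" "D \<subseteq> U" for n :: nat and U
    using that
  proof (induction n arbitrary: U)
    case 0
    obtain u where u: "good U u" using good_ex 0 by blast
    have "norm (apply_bcontfun (L f + u (V f)) x) \<le> (l + e' + K / real (0 + 1)) * norm f"
      if "f \<in> Z" for f x
    proof -
      have "norm (apply_bcontfun (L f + u (V f)) x) \<le> K * norm f" by (rule everywhere[OF u that])
      also have "\<dots> \<le> (l + e' + K / real (0 + 1)) * norm f"
        using l(1) \<open>e' > 0\<close> by (intro mult_right_mono) auto
      finally show ?thesis .
    qed
    with u show ?case by blast
  next
    case (Suc n)
    obtain u where u: "good U u" using good_ex Suc.prems by blast
    then have u_lift: "lifting D X1 X2 G Y (\<lambda>g. g) u" by (simp add: good_def)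
    define U' where
      "U' = U \<inter> interior {x. \<forall>f\<in>Z. norm (apply_bcontfun (L f + u (V f)) x) \<le> (l + e') * norm f}"
    have "open U'" unfolding U'_def using Suc.prems by blast
    have "D \<subseteq> interior {x. \<forall>f\<in>Z. norm (apply_bcontfun (L f + u (V f)) x) \<le> (l + e') * norm f}"
    proof (rule interior_small_values[OF _ \<open>e' > 0\<close>])
      have "equicontinuous_map_on Z (\<lambda>f. u (V f))"
        using u_lift V unfolding lifting_def by (blast intro: equicontinuous_map_on_compose)
      from equicontinuous_map_on_lincomb[OF L(1) this, of 1 1]
      show "equicontinuous_map_on Z (\<lambda>f. L f + u (V f))" by simp
    next
      fix f x assume "f \<in> Z" "x \<in> D"
      have "restr D (L f + u (V f)) = restr D (L f) + V f"
        using u_lift VG[OF \<open>f \<in> Z\<close>] by (simp add: lifting_def restr_add)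
      then have "norm (restr D (L f + u (V f))) \<le> l * norm f"
        using onD[OF \<open>f \<in> Z\<close>] by simp
      then show "norm (apply_bcontfun (L f + u (V f)) x) \<le> l * norm f"
        using norm_bounded[of "restr D (L f + u (V f))" "discrete x"] \<open>x \<in> D\<close>
        by (simp add: apply_restr discrete_inverse)
    qed
    then have "D \<subseteq> U'" using Suc.prems by (simp add: U'_def)
    obtain v where v: "good U' v" "\<And>f x. f \<in> Z \<Longrightarrow>
        norm (apply_bcontfun (L f + v (V f)) x) \<le> (l + e' + K / real (n + 1)) * norm f"
      using Suc.IH[OF \<open>open U'\<close> \<open>D \<subseteq> U'\<close>] by blast
    \<comment> \<open>The weights that give each of the \<open>n + 2\<close> liftings the same share.\<close>
    define a b where "a = 1 / real (n + 2)" and "b = real (n + 1) / real (n + 2)"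
    have ab: "a > 0" "b > 0" "a + b = 1" "a \<le> 1" "b \<le> 1"
      by (auto simp: a_def b_def field_simps)
    define w where "w g = a *\<^sub>R u g + b *\<^sub>R v g" for g
    have "good U w"
    proof -
      have "lifting D X1 X2 G Y (\<lambda>g. a *\<^sub>R g + b *\<^sub>R g) w"
        unfolding w_def using u v(1) unfolding good_def by (intro lifting_lincomb X1 X2) auto
      then have "lifting D X1 X2 G Y (\<lambda>g. g) w"
        using ab(3) by (simp add: scaleR_left_distrib[symmetric])
      moreover have "norm (w g) \<le> C * norm g" if "g \<in> G" for g
      proof -
        have "norm (w g) \<le> a * (C * norm g) + b * (C * norm g)"
          unfolding w_def using u v(1) ab(1,2) that unfolding good_def opnorm_on_le_def
          by (intro norm_triangle_le add_mono) (auto intro!: mult_left_mono)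
        also have "\<dots> = C * norm g" using ab(3) by (simp add: distrib_right[symmetric])
        finally show ?thesis .
      qed
      moreover have "norm (apply_bcontfun (w g) x) \<le> \<eta> * norm g" if "g \<in> G" "x \<notin> U" for g x
      proof -
        have "x \<notin> U'" using that by (simp add: U'_def)
        have "norm (apply_bcontfun (w g) x) \<le> a * (\<eta> * norm g) + b * (\<eta> * norm g)"
          unfolding w_def using u v(1) ab(1,2) that \<open>x \<notin> U'\<close> unfolding good_def
          by (auto intro!: mult_left_mono norm_triangle_le add_mono)
        also have "\<dots> = \<eta> * norm g" using ab(3) by (simp add: distrib_right[symmetric])
        finally show ?thesis .
      qed
      ultimately show ?thesis
        using \<open>0 \<le> C\<close> unfolding good_def opnorm_on_le_def by blast
    qed
    moreover have "norm (apply_bcontfun (L f + w (V f)) x) \<le> (l + e' + K / real (Suc n + 1)) * norm f"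
      if "f \<in> Z" for f x
    proof -
      let ?p = "norm (apply_bcontfun (L f + u (V f)) x)"
      let ?q = "norm (apply_bcontfun (L f + v (V f)) x)"
      have "L f + w (V f) = (a + b) *\<^sub>R L f + w (V f)" by (simp add: ab(3))
      also have "\<dots> = a *\<^sub>R (L f + u (V f)) + b *\<^sub>R (L f + v (V f))"
        by (simp add: w_def algebra_simps)
      finally have "apply_bcontfun (L f + w (V f)) x
          = a *\<^sub>R apply_bcontfun (L f + u (V f)) x + b *\<^sub>R apply_bcontfun (L f + v (V f)) x"
        by simp
      then have "norm (apply_bcontfun (L f + w (V f)) x) \<le> a * ?p + b * ?q"
        using ab(1,2) by (metis abs_of_pos norm_scaleR norm_triangle_ineq)
      also have "\<dots> \<le> (l + e' + K / real (Suc n + 1)) * norm f"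
      \<comment> \<open>In \<open>U'\<close> only the summand of \<open>v\<close> can exceed \<open>l + e'\<close>, off \<open>U'\<close> only that of \<open>u\<close>.\<close>
      proof (cases "x \<in> U'")
        case True
        then have p: "?p \<le> (l + e') * norm f"
          using interior_subset that unfolding U'_def by blast
        have "a * ?p + b * ?q \<le> a * ((l + e') * norm f) + b * ((l + e' + K / real (n + 1)) * norm f)"
          using p v(2)[OF that] ab by (intro add_mono mult_left_mono) auto
        also have "\<dots> = ((a + b) * (l + e') + b * (K / real (n + 1))) * norm f"
          by (simp add: algebra_simps)
        also have "b * (K / real (n + 1)) = K / real (Suc n + 1)"
          by (simp add: b_def)
        finally show ?thesis by (simp add: ab(3))
      next
        case False
        have "a * ?p + b * ?q \<le> a * (K * norm f) + b * ((l + e') * norm f)"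
          using everywhere[OF u that] outside[OF v(1) that False] ab
          by (intro add_mono mult_left_mono) auto
        also have "\<dots> \<le> a * (K * norm f) + 1 * ((l + e') * norm f)"
          using ab l(1) \<open>e' > 0\<close> by (intro add_left_mono mult_right_mono) auto
        also have "\<dots> = (l + e' + K / real (Suc n + 1)) * norm f"
          by (simp add: a_def algebra_simps)
        finally show ?thesis .
      qed
      finally show ?thesis .
    qed
    ultimately show ?case by blast
  qed
  obtain n :: nat where n: "K / e' < n" using reals_Archimedean2 by blast
  have "K / real (n + 1) \<le> e'" using n \<open>e' > 0\<close> by (simp add: field_simps)
  obtain u where u: "good U u" "\<And>f x. f \<in> Z \<Longrightarrow>
        norm (apply_bcontfun (L f + u (V f)) x) \<le> (l + e' + K / real (n + 1)) * norm f"
    using average[OF U] by blast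
  have "opnorm_on_le Z (\<lambda>f. L f + u (V f)) (l + e)"
    unfolding opnorm_on_le_def
  proof (intro conjI ballI)
    show "0 \<le> l + e" using l(1) e by simp
    fix f assume "f \<in> Z"
    have "norm (L f + u (V f)) \<le> (l + e' + K / real (n + 1)) * norm f"
      using u(2)[OF \<open>f \<in> Z\<close>] by (rule norm_bound)
    also have "\<dots> \<le> (l + e) * norm f"
    proof (rule mult_right_mono)
      have "e = e' + e'" by (simp add: e'_def)
      then show "l + e' + K / real (n + 1) \<le> l + e"
        using \<open>K / real (n + 1) \<le> e'\<close> by linarith
    qed simp
    finally show "norm (L f + u (V f)) \<le> (l + e) * norm f" .
  qed
  moreover have "norm (apply_bcontfun (u g) x) \<le> d * norm g" if "g \<in> G" "x \<notin> U" for g x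
  proof -
    have "norm (apply_bcontfun (u g) x) \<le> \<eta> * norm g" using u(1) that by (simp add: good_def)
    also have "\<dots> \<le> d * norm g" using \<open>\<eta> \<le> d\<close> by (intro mult_right_mono) auto
    finally show ?thesis .
  qed
  ultimately show ?thesis using u(1) unfolding good_def by blast
qed

lemma equicontinuous_map_on_zero: "equicontinuous_map_on Z (\<lambda>f. 0)"
  unfolding equicontinuous_map_on_def by (auto intro!: exI[of _ UNIV])

text \<open>
  Averaging with \<open>L = 0\<close> and \<open>V\<close> the identity. Any bound above \<open>1\<close> can be reached in this way; what
  counts is that \<open>2\<close> does not depend on \<open>G\<close>, since \<open>G\<close> changes from one approximating operator to the
  next.
\<close>

lemma localized_lifts_norm_2:
  assumes X1: "bc.subspace X1" and X2: "bc.subspace X2"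
    and loc: "localized_lifts D X1 X2 G Y C"
  shows "localized_lifts D X1 X2 G Y 2"
  unfolding localized_lifts_def
proof (intro allI impI, elim conjE)
  fix U and e :: real assume "0 < e" "open U" "D \<subseteq> U"
  have "\<exists>u. lifting D X1 X2 G Y (\<lambda>g. g) u \<and> opnorm_on_le G u C \<and>
      (\<forall>g\<in>G. \<forall>x. x \<notin> U \<longrightarrow> norm (apply_bcontfun (u g) x) \<le> e * norm g) \<and>
      opnorm_on_le G (\<lambda>f. 0 + u f) (1 + 1)"
    by (rule averaged_lift[OF X1 X2 loc equicontinuous_map_on_zero, where M = 1])
      (use \<open>0 < e\<close> \<open>open U\<close> \<open>D \<subseteq> U\<close> in \<open>auto simp: opnorm_on_le_def\<close>)
  then show "\<exists>u. lifting D X1 X2 G Y (\<lambda>g. g) u \<and> opnorm_on_le G u 2 \<and>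
      (\<forall>g\<in>G. \<forall>x. x \<notin> U \<longrightarrow> norm (apply_bcontfun (u g) x) \<le> e * norm g)"
    by auto
qed

section \<open>From one approximating operator to the next\<close>

definition finite_rank_on ::
    "('a::topological_space \<Rightarrow>\<^sub>C 's::real_normed_field) set \<Rightarrow> (('a \<Rightarrow>\<^sub>C 's) \<Rightarrow> ('a \<Rightarrow>\<^sub>C 's)) \<Rightarrow> bool"
  where "finite_rank_on Z S \<longleftrightarrow> (\<exists>B. finite B \<and> S ` Z \<subseteq> bc.span B)"

text \<open>
  The new lifting is \<open>(1 - e) L + u V\<close> with \<open>V = S' - (1 - e) S\<close>, where \<open>u\<close> lifts the inclusion of a
  finite-dimensional space containing the ranges of \<open>S\<close> and \<open>S'\<close>. Damping by \<open>1 - e\<close> is what makes the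
  norm bound of the new lifting independent of \<open>e\<close>: since \<open>l \<ge> 1\<close>, the product \<open>(1 - e) (l + e)\<close> is at
  most \<open>l\<close>. On \<open>D\<close> the new lifting agrees with \<open>S'\<close>, again of norm at most \<open>l\<close>, so the averaging
  lemma applies. The price is the extra terms proportional to \<open>e\<close> in the last estimate.
\<close>

lemma next_lift:
  fixes X1 X2 :: "('k::topological_space \<Rightarrow>\<^sub>C 's::{real_normed_field, banach}) set"
    and D :: "'k set"
  defines "E \<equiv> restr D ` X1" and "Y \<equiv> restr D ` X2"
  assumes X1: "bc.subspace X1" and X2: "bc.subspace X2" and sub: "X2 \<subseteq> X1"
    and bep: "bounded_extension_property D X1" "bounded_extension_property D X2"
    and S: "linear_map_on E S" "S ` E \<subseteq> E" "S ` Y \<subseteq> Y" "finite_rank_on E S" "opnorm_on_le E S l"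
    and S': "linear_map_on E S'" "S' ` E \<subseteq> E" "S' ` Y \<subseteq> Y" "finite_rank_on E S'" "opnorm_on_le E S' l"
    and L: "lifting D X1 X2 E Y S L" "opnorm_on_le E L (l + e)"
    and l: "l \<ge> 1" and e: "0 < e" "e \<le> 1" and e': "0 < e'"
  shows "\<exists>L'. lifting D X1 X2 E Y S' L' \<and> opnorm_on_le E L' (l + e') \<and>
    (\<forall>f\<in>E. norm (L' f - L f) \<le> e * (l + 1) * norm f + 2 * (norm (S' f - S f) + e * l * norm f))"
proof -
  have E: "bc.subspace E" and Ysub: "bc.subspace Y"
    unfolding E_def Y_def by (intro subspace_restr X1 X2)+
  obtain B B' where B: "finite B" "S ` E \<subseteq> bc.span B" and B': "finite B'" "S' ` E \<subseteq> bc.span B'"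
    using S(4) S'(4) unfolding finite_rank_on_def by blast
  define G where "G = E \<inter> bc.span (B \<union> B')"
  have "bc.subspace G" unfolding G_def by (intro bc.subspace_inter E bc.subspace_span)
  then have "\<exists>C. localized_lifts D X1 X2 G Y C"
    unfolding Y_def using B B'
    by (intro localized_lifts_finite_dim[where ?B0.0 = "B \<union> B'"] X1 X2 sub bep) (auto simp: G_def E_def)
  then have loc: "localized_lifts D X1 X2 G Y 2"
    using localized_lifts_norm_2[OF X1 X2] by blast
  have inG: "S f \<in> G" "S' f \<in> G" if "f \<in> E" for f
    using that S(2) S'(2) B(2) B'(2) bc.span_mono[of B "B \<union> B'"] bc.span_mono[of B' "B \<union> B'"]
    unfolding G_def by blast+
  define V where "V f = 1 *\<^sub>R S' f + (- (1 - e)) *\<^sub>R S f" for f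
  have V_lin: "linear_map_on E V" unfolding V_def by (intro linear_map_on_lincomb S S')
  have VG: "V ` E \<subseteq> G"
    unfolding V_def using inG \<open>bc.subspace G\<close> by (auto intro!: bc.subspace_add subspace_scaleR)
  have VY: "V ` (E \<inter> Y) \<subseteq> Y"
    unfolding V_def using S(3) S'(3) Ysub
    by (auto intro!: bc.subspace_add subspace_scaleR)
  have nS: "norm (S f) \<le> l * norm f" "norm (S' f) \<le> l * norm f" if "f \<in> E" for f
    using S(5) S'(5) that by (auto simp: opnorm_on_le_def)
  have nL: "norm (L f) \<le> (l + e) * norm f" if "f \<in> E" for f
    using L(2) that by (auto simp: opnorm_on_le_def)
  have V_eq: "V f = (S' f - S f) + e *\<^sub>R S f" for f by (simp add: V_def algebra_simps)
  have nV: "norm (V f) \<le> norm (S' f - S f) + e * l * norm f" if "f \<in> E" for f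
    unfolding V_eq using e nS(1)[OF that]
    by (intro norm_triangle_le) (simp add: mult.assoc mult_left_mono)
  have V_op: "opnorm_on_le E V (3 * l)"
    unfolding opnorm_on_le_def
  proof (intro conjI ballI)
    show "0 \<le> 3 * l" using l by simp
    fix f assume "f \<in> E"
    have "norm (S' f - S f) \<le> l * norm f + l * norm f"
      using nS[OF \<open>f \<in> E\<close>] norm_triangle_ineq4[of "S' f" "S f"] by linarith
    moreover have "e * l * norm f \<le> 1 * l * norm f"
      using e l by (intro mult_right_mono) auto
    ultimately show "norm (V f) \<le> 3 * l * norm f" using nV[OF \<open>f \<in> E\<close>] by simp
  qed
  \<comment> \<open>Smallness away from \<open>D\<close> has served its purpose inside the averaging lemma, hence the
    neighbourhood \<open>UNIV\<close>.\<close>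
  have "\<exists>u. lifting D X1 X2 G Y (\<lambda>g. g) u \<and> opnorm_on_le G u 2 \<and>
    (\<forall>g\<in>G. \<forall>x. x \<notin> UNIV \<longrightarrow> norm (apply_bcontfun (u g) x) \<le> 1 * norm g) \<and>
    opnorm_on_le E (\<lambda>f. (1 - e) *\<^sub>R L f + u (V f)) (l + e')"
  proof (rule averaged_lift[OF X1 X2 loc _ _ VG V_op])
    have "equicontinuous_map_on E L" using L(1) by (simp add: lifting_def)
    from equicontinuous_map_on_lincomb[OF this this, of "1 - e" 0]
    show "equicontinuous_map_on E (\<lambda>f. (1 - e) *\<^sub>R L f)" by simp
    show "opnorm_on_le E (\<lambda>f. (1 - e) *\<^sub>R L f) l"
      unfolding opnorm_on_le_def
    proof (intro conjI ballI)
      fix f assume "f \<in> E"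
      have "norm ((1 - e) *\<^sub>R L f) \<le> (1 - e) * ((l + e) * norm f)"
        using nL[OF \<open>f \<in> E\<close>] e by (simp add: mult_left_mono)
      also have "(1 - e) * (l + e) = l - (e * (l - 1) + e * e)" by (simp add: algebra_simps)
      then have "(1 - e) * ((l + e) * norm f) = (l - (e * (l - 1) + e * e)) * norm f"
        by (simp add: mult.assoc[symmetric])
      also have "\<dots> \<le> l * norm f"
      proof (rule mult_right_mono)
        have "0 \<le> e * (l - 1)" "0 \<le> e * e" using l e by simp_all
        then show "l - (e * (l - 1) + e * e) \<le> l" by linarith
      qed simp
      finally show "norm ((1 - e) *\<^sub>R L f) \<le> l * norm f" .
    qed (use l in simp)
    fix f assume "f \<in> E"
    then have "restr D ((1 - e) *\<^sub>R L f) + V f = S' f"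
      using L(1) by (simp add: lifting_def restr_scaleR V_def restr_diff scaleR_left_diff_distrib)
    then show "norm (restr D ((1 - e) *\<^sub>R L f) + V f) \<le> l * norm f"
      using nS(2)[OF \<open>f \<in> E\<close>] by simp
  qed (use e' in auto)
  then obtain u where u: "lifting D X1 X2 G Y (\<lambda>g. g) u" "opnorm_on_le G u 2"
    "opnorm_on_le E (\<lambda>f. (1 - e) *\<^sub>R L f + u (V f)) (l + e')"
    by blast
  define L' where "L' f = (1 - e) *\<^sub>R L f + 1 *\<^sub>R u (V f)" for f
  have "lifting D X1 X2 E Y (\<lambda>f. (1 - e) *\<^sub>R S f + 1 *\<^sub>R V f) L'"
    unfolding L'_def
    by (intro lifting_lincomb X1 X2 L lifting_compose[OF u(1) V_lin VG VY V_op])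
  moreover have "(\<lambda>f. (1 - e) *\<^sub>R S f + 1 *\<^sub>R V f) = S'"
    by (simp add: V_def scaleR_left_diff_distrib)
  ultimately have "lifting D X1 X2 E Y S' L'" by simp
  moreover have "opnorm_on_le E L' (l + e')"
    using u(3) by (simp add: L'_def opnorm_on_le_def)
  moreover have "norm (L' f - L f) \<le> e * (l + 1) * norm f + 2 * (norm (S' f - S f) + e * l * norm f)"
    if "f \<in> E" for f
  proof -
    have "L' f - L f = (- e) *\<^sub>R L f + u (V f)" by (simp add: L'_def algebra_simps)
    moreover have "norm ((- e) *\<^sub>R L f) \<le> e * (l + 1) * norm f"
    proof -
      have "norm (L f) \<le> (l + 1) * norm f"
        using nL[OF that] e by (meson add_left_mono mult_right_mono norm_ge_zero order_trans)
      then show ?thesis using e by (simp add: mult.assoc mult_left_mono)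
    qed
    moreover have "norm (u (V f)) \<le> 2 * (norm (S' f - S f) + e * l * norm f)"
    proof -
      have "V f \<in> G" using VG that by blast
      then have "norm (u (V f)) \<le> 2 * norm (V f)" using u(2) by (simp add: opnorm_on_le_def)
      also have "\<dots> \<le> 2 * (norm (S' f - S f) + e * l * norm f)"
        using nV[OF that] by (rule mult_left_mono) simp
      finally show ?thesis .
    qed
    ultimately show ?thesis by (simp only: norm_triangle_le add_mono)
  qed
  ultimately show ?thesis by blast
qed

section \<open>Passage to the limit\<close>

lemma bounded_linear_scale_bcontfun: "bounded_linear (scale_bcontfun c)"
  by (rule bounded_linear_intro[where K = "norm c"])
    (simp_all add: bc.scale_right_distrib scale_bcontfun_scaleR norm_scale_bcontfun mult.commute)

lemma bounded_linear_restr: "bounded_linear (restr D)"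
  by (rule bounded_linear_intro[where K = 1])
    (simp_all add: restr_add restr_scaleR norm_restr_le)

lemma linear_map_on_diff:
  assumes "linear_map_on E T" "bc.subspace E" "f \<in> E" "g \<in> E"
  shows "T (f - g) = T f - T g"
proof -
  have "f - g \<in> E" using assms(2-4) by (rule bc.subspace_diff)
  then have "T ((f - g) + g) = T (f - g) + T g"
    using assms(1,4) unfolding linear_map_on_def by blast
  then show ?thesis by simp
qed

text \<open>
  A Cauchy sequence for the supremum norm converges uniformly, and a uniform limit of bounded
  continuous functions is again bounded and continuous.
\<close>

lemma Cauchy_bcontfun_convergent:
  fixes f :: "nat \<Rightarrow> ('a::topological_space \<Rightarrow>\<^sub>C 'b::complete_space)"
  assumes "Cauchy f"
  shows "convergent f"
proof -
  have "uniformly_Cauchy_on UNIV (\<lambda>n. apply_bcontfun (f n))"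
  proof (rule uniformly_Cauchy_onI)
    fix e :: real assume "e > 0"
    then obtain M where M: "\<And>m n. m \<ge> M \<Longrightarrow> n \<ge> M \<Longrightarrow> dist (f m) (f n) < e"
      using metric_CauchyD[OF assms] by blast
    then show "\<exists>M. \<forall>x\<in>UNIV. \<forall>m\<ge>M. \<forall>n\<ge>M. dist (apply_bcontfun (f m) x) (apply_bcontfun (f n) x) < e"
      by (intro exI[of _ M]) (simp add: dist_fun_lt_imp_dist_val_lt)
  qed
  then have "uniformly_convergent_on UNIV (\<lambda>n. apply_bcontfun (f n))"
    by (rule Cauchy_uniformly_convergent)
  then obtain g where g: "uniform_limit UNIV (\<lambda>n. apply_bcontfun (f n)) g sequentially"
    unfolding uniformly_convergent_on_def ..
  obtain l where "f \<longlonglongrightarrow> l"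
    using uniform_limit_bcontfunE[OF g sequentially_bot] .
  then show ?thesis by (rule convergentI)
qed

text \<open>
  The sum of the steps from \<open>n\<close> to \<open>n + k\<close> is at most the difference of two terms of the geometric
  sequence \<open>2 * K * (1/2) ^ n\<close>, which telescopes in the induction on \<open>k\<close>.
\<close>

lemma convergent_if_geometric_steps:
  fixes f :: "nat \<Rightarrow> ('a::topological_space \<Rightarrow>\<^sub>C 'b::banach)"
  assumes step: "\<And>n. n \<ge> N \<Longrightarrow> norm (f (Suc n) - f n) \<le> K * (1/2) ^ n"
  shows "convergent f"
proof (rule Cauchy_bcontfun_convergent, rule CauchyI')
  fix e :: real assume "e > 0"
  have far: "norm (f (n + k) - f n) \<le> 2 * K * ((1/2) ^ n - (1/2) ^ (n + k))" if "n \<ge> N" for n k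
  proof (induction k)
    case (Suc k)
    have "norm (f (n + Suc k) - f n) \<le> norm (f (Suc (n + k)) - f (n + k)) + norm (f (n + k) - f n)"
      using norm_triangle_ineq[of "f (Suc (n + k)) - f (n + k)" "f (n + k) - f n"] by simp
    also have "\<dots> \<le> K * (1/2) ^ (n + k) + 2 * K * ((1/2) ^ n - (1/2) ^ (n + k))"
      using that by (intro add_mono step Suc.IH) simp
    also have "\<dots> = 2 * K * ((1/2) ^ n - (1/2) ^ (n + Suc k))"
      by (simp add: algebra_simps)
    finally show ?case .
  qed simp
  have "0 \<le> K * (1/2) ^ N" using step[of N] norm_ge_zero order_trans by blast
  then have "K \<ge> 0" using mult_right_le_imp_le[of 0 "(1/2) ^ N" K] by simp
  have "(\<lambda>n. 2 * K * (1/2) ^ n) \<longlonglongrightarrow> 2 * K * 0"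
    by (intro tendsto_mult tendsto_const LIMSEQ_power_zero) simp
  then have "\<forall>\<^sub>F n in sequentially. 2 * K * (1/2) ^ n < e"
    using \<open>e > 0\<close> by (intro order_tendstoD) simp_all
  then obtain M where M: "\<And>n. n \<ge> M \<Longrightarrow> 2 * K * (1/2) ^ n < e"
    unfolding eventually_sequentially by blast
  have "norm (f n - f m) < e" if "m \<ge> max M N" "m < n" for m n
  proof -
    have "f n - f m = f (m + (n - m)) - f m" using that by simp
    also have "norm \<dots> \<le> 2 * K * ((1/2) ^ m - (1/2) ^ (m + (n - m)))"
      by (rule far) (use that in simp)
    also have "\<dots> \<le> 2 * K * (1/2) ^ m" using \<open>K \<ge> 0\<close> by (intro mult_left_mono) auto
    also have "\<dots> < e" by (rule M) (use that in simp)
    finally show ?thesis .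
  qed
  then show "\<exists>M. \<forall>m\<ge>M. \<forall>n>m. dist (f m) (f n) < e"
    by (intro exI[of _ "max M N"]) (simp add: dist_norm norm_minus_commute)
qed

lemma convergent_if_convergent_on_dense:
  fixes L :: "nat \<Rightarrow> ('a::topological_space \<Rightarrow>\<^sub>C 's::{real_normed_field, banach})
    \<Rightarrow> ('b::topological_space \<Rightarrow>\<^sub>C 's)"
  assumes lin: "\<And>n. linear_map_on E (L n)" and E: "bc.subspace E"
    and bound: "\<And>n. opnorm_on_le E (L n) M"
    and dense: "\<And>f e. f \<in> E \<Longrightarrow> e > 0 \<Longrightarrow> \<exists>d\<in>A. norm (f - d) < e" and "A \<subseteq> E"
    and conv: "\<And>d. d \<in> A \<Longrightarrow> convergent (\<lambda>n. L n d)"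
    and f: "f \<in> E"
  shows "convergent (\<lambda>n. L n f)"
proof -
  have M: "0 \<le> M" "\<And>n f. f \<in> E \<Longrightarrow> norm (L n f) \<le> M * norm f"
    using bound by (auto simp: opnorm_on_le_def)
  then have "M + 1 > 0" by simp
  have "Cauchy (\<lambda>n. L n f)"
  proof (rule CauchyI)
    fix e :: real assume "e > 0"
    then have "e / 3 / (M + 1) > 0" using M(1) by simp
    then obtain d where d: "d \<in> A" "norm (f - d) < e / 3 / (M + 1)"
      using dense[OF f] by blast
    have dE: "d \<in> E" using d(1) \<open>A \<subseteq> E\<close> by blast
    have close: "norm (L n f - L n d) < e / 3" for n
    proof -
      have "norm (L n f - L n d) = norm (L n (f - d))"
        by (simp add: linear_map_on_diff[OF lin E f dE])
      also have "\<dots> \<le> M * norm (f - d)" by (intro M(2) bc.subspace_diff[OF E] f dE)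
      also have "\<dots> \<le> (M + 1) * norm (f - d)" by (intro mult_right_mono) auto
      also have "\<dots> = norm (f - d) * (M + 1)" by (rule mult.commute)
      also have "\<dots> < e / 3" using d(2) unfolding pos_less_divide_eq[OF \<open>M + 1 > 0\<close>] .
      finally show ?thesis .
    qed
    have "Cauchy (\<lambda>n. L n d)" using conv[OF d(1)] by (rule convergent_Cauchy)
    then obtain N where N: "\<And>m n. m \<ge> N \<Longrightarrow> n \<ge> N \<Longrightarrow> norm (L m d - L n d) < e / 3"
      using CauchyD[of "\<lambda>n. L n d" "e / 3"] \<open>e > 0\<close> by auto
    have "norm (L m f - L n f) < e" if "m \<ge> N" "n \<ge> N" for m n
    proof -
      have "L m f - L n f = (L m f - L m d) + (L m d - L n d) - (L n f - L n d)" by simp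
      also have "norm \<dots> \<le> norm (L m f - L m d) + norm (L m d - L n d) + norm (L n f - L n d)"
        by (meson add_right_mono norm_triangle_ineq norm_triangle_ineq4 order_trans)
      also have "\<dots> < e" using close[of m] close[of n] N[OF that] by linarith
      finally show ?thesis .
    qed
    then show "\<exists>N. \<forall>m\<ge>N. \<forall>n\<ge>N. norm (L m f - L n f) < e" by blast
  qed
  then show ?thesis by (rule Cauchy_bcontfun_convergent)
qed

text \<open>
  The error \<open>(1/2) ^ n\<close> governs both the approximation of the first \<open>n\<close> members of \<open>d\<close> by \<open>S n\<close> and
  the excess norm of \<open>L n\<close>, so that at each \<open>d j\<close> the step from \<open>L n\<close> to \<open>L (Suc n)\<close> is eventually at
  most a constant times \<open>(1/2) ^ n\<close>.
\<close>

lemma lifting_sequence: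
  fixes X1 X2 :: "('k::topological_space \<Rightarrow>\<^sub>C 's::{real_normed_field, banach}) set"
    and D :: "'k set" and d :: "nat \<Rightarrow> ('k discrete \<Rightarrow>\<^sub>C 's)"
  defines "E \<equiv> restr D ` X1" and "Y \<equiv> restr D ` X2"
  assumes X1: "bc.subspace X1" and X2: "bc.subspace X2" and sub: "X2 \<subseteq> X1"
    and bep: "bounded_extension_property D X1" "bounded_extension_property D X2"
    and bap: "pair_BAP l E Y" and l: "l \<ge> 1" and d: "range d \<subseteq> E"
  shows "\<exists>S L. (\<forall>n. lifting D X1 X2 E Y (S n) (L n) \<and> opnorm_on_le E (L n) (l + (1/2) ^ n)) \<and>
    (\<forall>j. (\<lambda>n. S n (d j)) \<longlonglongrightarrow> d j) \<and> (\<forall>j. convergent (\<lambda>n. L n (d j)))"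
proof -
  have E: "bc.subspace E" and Ysub: "bc.subspace Y"
    unfolding E_def Y_def by (intro subspace_restr X1 X2)+
  \<comment> \<open>At \<open>n = 0\<close> nothing has to be approximated, so that \<open>S 0 = 0\<close>, lifted by \<open>0\<close>, starts the
    recursion.\<close>
  define approx where "approx n S \<longleftrightarrow> linear_map_on E S \<and> S ` E \<subseteq> E \<and> S ` Y \<subseteq> Y \<and>
      finite_rank_on E S \<and> opnorm_on_le E S l \<and> (\<forall>j<n. norm (S (d j) - d j) \<le> (1/2) ^ n)" for n S
  have "\<exists>S. approx n S \<and> (n = 0 \<longrightarrow> S = (\<lambda>f. 0))" for n
  proof (cases "n = 0")
    case True
    have "approx 0 (\<lambda>f. 0)"
      unfolding approx_def finite_rank_on_def linear_map_on_def opnorm_on_le_def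
      using l bc.subspace_0[OF E] bc.subspace_0[OF Ysub]
      by (auto intro!: exI[of _ "{}"])
    with True show ?thesis by blast
  next
    case False
    have "compact (d ` {..<n})" "d ` {..<n} \<subseteq> E" using d by (auto intro: finite_imp_compact)
    then obtain S where S: "linear_map_on E S" "S ` E \<subseteq> E" "\<exists>B. finite B \<and> S ` E \<subseteq> bc.span B"
        "opnorm_on_le E S l" "\<forall>z\<in>d ` {..<n}. norm (S z - z) \<le> (1/2) ^ n" "S ` Y \<subseteq> Y"
      using bap[unfolded pair_BAP_def, rule_format, of "(1/2) ^ n" "d ` {..<n}"] by auto
    then have "approx n S" unfolding approx_def finite_rank_on_def by simp
    with False show ?thesis by blast
  qed
  then obtain S where "\<forall>n. approx n (S n) \<and> (n = 0 \<longrightarrow> S n = (\<lambda>f. 0))"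
    using choice[of "\<lambda>n S. approx n S \<and> (n = 0 \<longrightarrow> S = (\<lambda>f. 0))"] by blast
  then have S: "approx n (S n)" and S0: "S 0 = (\<lambda>f. 0)" for n by auto
  define P where "P n L \<longleftrightarrow> lifting D X1 X2 E Y (S n) L \<and> opnorm_on_le E L (l + (1/2) ^ n)" for n L
  define Q where "Q n L L' \<longleftrightarrow> (\<forall>f\<in>E. norm (L' f - L f)
      \<le> (1/2) ^ n * (l + 1) * norm f + 2 * (norm (S (Suc n) f - S n f) + (1/2) ^ n * l * norm f))"
    for n and L L' :: "('k discrete \<Rightarrow>\<^sub>C 's) \<Rightarrow> ('k \<Rightarrow>\<^sub>C 's)"
  have "\<exists>L. \<forall>n. P n (L n) \<and> Q n (L n) (L (Suc n))"
  proof (rule dependent_nat_choice)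
    have "P 0 (\<lambda>f. 0)"
      using l bc.subspace_0[OF X1] bc.subspace_0[OF X2]
      by (simp add: P_def S0 lifting_def linear_map_on_def opnorm_on_le_def equicontinuous_map_on_zero)
    then show "\<exists>L. P 0 L" by blast
  next
    fix L n assume "P n L"
    then have L: "lifting D X1 X2 E Y (S n) L" "opnorm_on_le E L (l + (1/2) ^ n)"
      by (simp_all add: P_def)
    have e: "0 < (1/2::real) ^ n" "(1/2::real) ^ n \<le> 1" "0 < (1/2::real) ^ Suc n"
      by (simp_all add: power_le_one)
    note Sn = S[of n, unfolded approx_def] and Sn' = S[of "Suc n", unfolded approx_def]
    have "\<exists>L'. lifting D X1 X2 E Y (S (Suc n)) L' \<and> opnorm_on_le E L' (l + (1/2) ^ Suc n) \<and>
        (\<forall>f\<in>E. norm (L' f - L f)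
          \<le> (1/2) ^ n * (l + 1) * norm f + 2 * (norm (S (Suc n) f - S n f) + (1/2) ^ n * l * norm f))"
      using Sn Sn' L unfolding E_def Y_def by (intro next_lift X1 X2 sub bep l e) auto
    then show "\<exists>L'. P (Suc n) L' \<and> Q n L L'"
      unfolding P_def Q_def by blast
  qed
  then obtain L where L: "\<And>n. P n (L n)" "\<And>n. Q n (L n) (L (Suc n))" by blast
  have Sd: "norm (S n (d j) - d j) \<le> (1/2) ^ n" if "j < n" for n j
    using S[of n] that by (simp add: approx_def)
  have half0: "(\<lambda>n. (1/2) ^ n) \<longlonglongrightarrow> (0::real)" by (rule LIMSEQ_power_zero) simp
  have "(\<lambda>n. S n (d j)) \<longlonglongrightarrow> d j" for j
  proof (rule LIM_zero_cancel, rule Lim_null_comparison[OF _ half0])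
    show "\<forall>\<^sub>F n in sequentially. norm (S n (d j) - d j) \<le> (1/2) ^ n"
      using eventually_gt_at_top[of j] by eventually_elim (rule Sd)
  qed
  moreover have "convergent (\<lambda>n. L n (d j))" for j
  proof -
    define K where "K = (l + 1) * norm (d j) + 2 * (2 + l * norm (d j))"
    have "d j \<in> E" using d by blast
    have "norm (L (Suc n) (d j) - L n (d j)) \<le> K * (1/2) ^ n" if "n \<ge> Suc j" for n
    proof -
      have "norm (S (Suc n) (d j) - S n (d j)) \<le> (1/2) ^ Suc n + (1/2) ^ n"
        using norm_triangle_ineq4[of "S (Suc n) (d j) - d j" "S n (d j) - d j"]
          Sd[of j "Suc n"] Sd[of j n] that by simp
      also have "\<dots> \<le> 2 * (1/2) ^ n" by simp
      finally have "norm (S (Suc n) (d j) - S n (d j)) \<le> 2 * (1/2) ^ n" .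
      then have S_step: "norm (S (Suc n) (d j) - S n (d j)) + (1/2) ^ n * l * norm (d j)
          \<le> 2 * (1/2) ^ n + (1/2) ^ n * l * norm (d j)"
        by (rule add_right_mono)
      have "norm (L (Suc n) (d j) - L n (d j)) \<le> (1/2) ^ n * (l + 1) * norm (d j) +
          2 * (norm (S (Suc n) (d j) - S n (d j)) + (1/2) ^ n * l * norm (d j))"
        using L(2)[of n] \<open>d j \<in> E\<close> unfolding Q_def by blast
      also have "\<dots> \<le> (1/2) ^ n * (l + 1) * norm (d j) +
          2 * (2 * (1/2) ^ n + (1/2) ^ n * l * norm (d j))"
        by (intro add_left_mono mult_left_mono S_step) simp
      also have "\<dots> = K * (1/2) ^ n"
        by (simp add: K_def algebra_simps)
      finally show ?thesis .
    qed
    then show ?thesis by (rule convergent_if_geometric_steps)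
  qed
  ultimately show ?thesis using L(1) unfolding P_def by blast
qed

text \<open>
  Operators close to the identity at a nonzero vector cannot have norm much below \<open>1\<close>.
\<close>

lemma pair_BAP_ge_1:
  assumes "pair_BAP l Z Y" "f \<in> Z" "f \<noteq> 0"
  shows "l \<ge> 1"
proof -
  have "norm f \<le> l * norm f + e" if e: "e > 0" for e
  proof -
    obtain S where "opnorm_on_le Z S l" "norm (S f - f) \<le> e"
      using assms(1)[unfolded pair_BAP_def, rule_format, of e "{f}"] e assms(2) by auto
    moreover have "norm f \<le> norm (S f) + norm (S f - f)"
      by (metis norm_minus_commute norm_triangle_sub)
    ultimately show ?thesis using assms(2) unfolding opnorm_on_le_def by fastforce
  qed
  then have "norm f \<le> l * norm f" by (rule field_le_epsilon)
  then show ?thesis using assms(3) by simp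
qed

lemma separable_dense_sequence:
  fixes E :: "'a::real_normed_vector set"
  assumes "separable_space (top_of_set E)" "E \<noteq> {}"
  shows "\<exists>d :: nat \<Rightarrow> 'a. range d \<subseteq> E \<and> (\<forall>f\<in>E. \<forall>e>0. \<exists>j. norm (f - d j) < e)"
proof -
  obtain A where A: "countable A" "A \<subseteq> E" "top_of_set E closure_of A = E"
    using assms(1) unfolding separable_space_def by auto
  have "A \<noteq> {}" using A(3) assms(2) by auto
  have clos: "E \<subseteq> closure A" using A(2,3) by (auto simp: closure_of_subtopology Int_absorb1)
  have "\<exists>j. norm (f - from_nat_into A j) < e" if f: "f \<in> E" and e: "e > 0" for f e
  proof -
    have "\<exists>a\<in>A. dist a f < e" using clos f e by (auto simp: closure_approachable)
    then obtain a where a: "a \<in> A" "dist a f < e" by blast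
    obtain j where "from_nat_into A j = a"
      using from_nat_into_surj[OF A(1) a(1)] by blast
    with a(2) show ?thesis by (auto simp: dist_norm norm_minus_commute)
  qed
  moreover have "range (from_nat_into A) \<subseteq> E" using A(1,2) \<open>A \<noteq> {}\<close> by simp
  ultimately show ?thesis by blast
qed

theorem corollary5p5:
  fixes X1 X2 :: "('k::t2_space \<Rightarrow>\<^sub>C 's::{real_normed_field, euclidean_space}) set"
    and D :: "'k set" and l :: real
  assumes "compact (UNIV :: 'k set)"
    and "module.subspace scale_bcontfun X1" and "closed X1"
    and "module.subspace scale_bcontfun X2" and "closed X2"
    and "X2 \<subseteq> X1"
    and "closed D"
    and "bounded_extension_property D X1"
    and "bounded_extension_property D X2"
    and "separable_space (top_of_set (restr D ` X1))"
    and "pair_BAP l (restr D ` X1) (restr D ` X2)"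
  shows "\<exists>T :: ('k discrete \<Rightarrow>\<^sub>C 's) \<Rightarrow> ('k \<Rightarrow>\<^sub>C 's).
    linear_map_on (restr D ` X1) T \<and>
    T ` (restr D ` X1) \<subseteq> X1 \<and>
    T ` (restr D ` X2) \<subseteq> X2 \<and>
    (\<forall>f \<in> restr D ` X1. \<forall>k\<in>D. apply_bcontfun (T f) k = apply_bcontfun f (discrete k)) \<and>
    opnorm_on_le (restr D ` X1) T l"
proof -
  note X1 = assms(2) and X2 = assms(4) and sub = assms(6) and bep = assms(8,9)
  define E where "E = restr D ` X1"
  define Y where "Y = restr D ` X2"
  have E: "bc.subspace E" unfolding E_def by (rule subspace_restr[OF X1])
  have "Y \<subseteq> E" unfolding E_def Y_def using sub by blast
  have bap: "pair_BAP l E Y" unfolding E_def Y_def by (rule assms(11))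
  have "\<exists>T. linear_map_on E T \<and> T ` E \<subseteq> X1 \<and> T ` Y \<subseteq> X2 \<and> (\<forall>f\<in>E. restr D (T f) = f) \<and>
      opnorm_on_le E T l"
  \<comment> \<open>If there are no nonzero restrictions, \<open>l\<close> may be less than \<open>1\<close>, and damping by \<open>1 - e\<close> need
    not bring a norm from \<open>l + e\<close> down to \<open>l\<close>.\<close>
  proof (cases "E \<subseteq> {0}")
    case True
    have "0 \<le> l"
      using bap[unfolded pair_BAP_def, rule_format, of 1 "{}"] by (auto simp: opnorm_on_le_def)
    have zero: "0 = f" if "f \<in> E" for f using True that by blast
    show ?thesis
      using \<open>0 \<le> l\<close> bc.subspace_0[OF X1] bc.subspace_0[OF X2] zero
      by (intro exI[of _ "\<lambda>f. 0"]) (simp add: linear_map_on_def opnorm_on_le_def image_subset_iff)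
  next
    case False
    then have l: "l \<ge> 1" using pair_BAP_ge_1[OF bap] by blast
    have "E \<noteq> {}" using False by blast
    from separable_dense_sequence[OF assms(10)[folded E_def] this]
    obtain d :: "nat \<Rightarrow> ('k discrete \<Rightarrow>\<^sub>C 's)" where d0: "range d \<subseteq> E \<and> (\<forall>f\<in>E. \<forall>e>0. \<exists>j. norm (f - d j) < e)" ..
    then have d: "range d \<subseteq> E" "\<And>f e. f \<in> E \<Longrightarrow> e > 0 \<Longrightarrow> \<exists>j. norm (f - d j) < e"
      by simp_all
    from lifting_sequence[OF X1 X2 sub bep, folded E_def Y_def, OF bap l d(1)]
    obtain S L where SL: "(\<forall>n. lifting D X1 X2 E Y (S n) (L n) \<and> opnorm_on_le E (L n) (l + (1/2) ^ n)) \<and>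
        (\<forall>j. (\<lambda>n. S n (d j)) \<longlonglongrightarrow> d j) \<and> (\<forall>j. convergent (\<lambda>n. L n (d j)))"
      by (elim exE)
    then have L: "lifting D X1 X2 E Y (S n) (L n)" "opnorm_on_le E (L n) (l + (1/2) ^ n)"
      and Sd: "(\<lambda>n. S n (d j)) \<longlonglongrightarrow> d j" and Ld: "convergent (\<lambda>n. L n (d j))" for n j
      by simp_all
    have lin: "linear_map_on E (L n)" for n using L(1)[of n] by (simp add: lifting_def)
    have "opnorm_on_le E (L n) (l + 1)" for n
    proof -
      have "(l + (1/2) ^ n) * norm f \<le> (l + 1) * norm f" for f :: "'k discrete \<Rightarrow>\<^sub>C 's"
        by (intro mult_right_mono add_left_mono) (auto simp: power_le_one)
      then show ?thesis
        using L(2)[of n] l unfolding opnorm_on_le_def by (auto intro: order_trans)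
    qed
    then have conv: "convergent (\<lambda>n. L n f)" if "f \<in> E" for f
      by (rule convergent_if_convergent_on_dense[OF lin E, where A = "range d"])
        (use d Ld that in auto)
    define T where "T f = lim (\<lambda>n. L n f)" for f
    have T: "(\<lambda>n. L n f) \<longlonglongrightarrow> T f" if "f \<in> E" for f
      unfolding T_def using conv[OF that] by (simp add: convergent_LIMSEQ_iff)
    have T_lin: "linear_map_on E T"
      unfolding linear_map_on_def
    proof (intro conjI ballI allI)
      fix f g assume fg: "f \<in> E" "g \<in> E"
      then have "f + g \<in> E" by (rule bc.subspace_add[OF E])
      moreover have "L n (f + g) = L n f + L n g" for n
        using lin[of n] fg by (simp add: linear_map_on_def)
      ultimately have "(\<lambda>n. L n f + L n g) \<longlonglongrightarrow> T (f + g)" using T[of "f + g"] by simp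
      then show "T (f + g) = T f + T g"
        using tendsto_add[OF T[OF fg(1)] T[OF fg(2)]] by (rule LIMSEQ_unique)
    next
      fix c f assume f: "f \<in> E"
      then have "scale_bcontfun c f \<in> E" by (rule bc.subspace_scale[OF E])
      moreover have "L n (scale_bcontfun c f) = scale_bcontfun c (L n f)" for n
        using lin[of n] f by (simp add: linear_map_on_def)
      ultimately have "(\<lambda>n. scale_bcontfun c (L n f)) \<longlonglongrightarrow> T (scale_bcontfun c f)"
        using T[of "scale_bcontfun c f"] by simp
      then show "T (scale_bcontfun c f) = scale_bcontfun c (T f)"
        using bounded_linear.tendsto[OF bounded_linear_scale_bcontfun T[OF f]] by (rule LIMSEQ_unique)
    qed
    have T_norm: "norm (T f) \<le> l * norm f" if "f \<in> E" for f
    proof (rule LIMSEQ_le)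
      show "(\<lambda>n. norm (L n f)) \<longlonglongrightarrow> norm (T f)" by (intro tendsto_norm T that)
      have "(\<lambda>n. (1/2) ^ n) \<longlonglongrightarrow> (0::real)" by (rule LIMSEQ_power_zero) simp
      then have "(\<lambda>n. (l + (1/2) ^ n) * norm f) \<longlonglongrightarrow> (l + 0) * norm f"
        by (intro tendsto_add tendsto_mult tendsto_const)
      then show "(\<lambda>n. (l + (1/2) ^ n) * norm f) \<longlonglongrightarrow> l * norm f" by simp
      show "\<exists>N. \<forall>n\<ge>N. norm (L n f) \<le> (l + (1/2) ^ n) * norm f"
        using L(2) that by (auto simp: opnorm_on_le_def)
    qed
    \<comment> \<open>\<open>T\<close> extends the members of the dense sequence, and then all of \<open>E\<close> by continuity.\<close>
    have T_d: "restr D (T (d j)) = d j" for j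
    proof (rule LIMSEQ_unique[OF _ Sd])
      have "d j \<in> E" using d(1) by blast
      moreover from this have "restr D (L n (d j)) = S n (d j)" for n
        using L(1)[of n] by (simp add: lifting_def)
      ultimately show "(\<lambda>n. S n (d j)) \<longlonglongrightarrow> restr D (T (d j))"
        using bounded_linear.tendsto[OF bounded_linear_restr[of D] T[of "d j"]] by simp
    qed
    have "restr D (T f) = f" if f: "f \<in> E" for f
    proof -
      have "norm (restr D (T f) - f) \<le> 0 + e" if "e > 0" for e
      proof -
        have "e / (l + 1) > 0" using that l by simp
        then obtain j where j: "norm (f - d j) < e / (l + 1)" using d(2)[OF f] by blast
        have dE: "d j \<in> E" using d(1) by blast
        have "restr D (T f) - f = restr D (T (f - d j)) - (f - d j)"
          by (simp add: linear_map_on_diff[OF T_lin E f dE] restr_diff T_d)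
        also have "norm \<dots> \<le> norm (restr D (T (f - d j))) + norm (f - d j)"
          by (rule norm_triangle_ineq4)
        also have "\<dots> \<le> l * norm (f - d j) + norm (f - d j)"
          using norm_restr_le[of D "T (f - d j)"] T_norm[OF bc.subspace_diff[OF E f dE]] by linarith
        also have "\<dots> = norm (f - d j) * (l + 1)" by (simp add: algebra_simps)
        also have "\<dots> \<le> e" using j l by (simp add: pos_less_divide_eq)
        finally show ?thesis by simp
      qed
      then have "norm (restr D (T f) - f) \<le> 0" by (rule field_le_epsilon)
      then show ?thesis by simp
    qed
    moreover have "T f \<in> X1" if "f \<in> E" for f
      using closed_sequentially[OF assms(3) _ T[OF that]] L(1) that by (auto simp: lifting_def)
    moreover have "T f \<in> X2" if "f \<in> Y" for f
      using closed_sequentially[OF assms(5) _ T[of f]] L(1) that \<open>Y \<subseteq> E\<close> by (auto simp: lifting_def)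
    moreover have "opnorm_on_le E T l" using T_norm l by (simp add: opnorm_on_le_def)
    ultimately show ?thesis using T_lin by blast
  qed
  then obtain T where T: "linear_map_on E T" "T ` E \<subseteq> X1" "T ` Y \<subseteq> X2"
    "\<And>f. f \<in> E \<Longrightarrow> restr D (T f) = f" "opnorm_on_le E T l"
    by blast
  have "apply_bcontfun (T f) k = apply_bcontfun f (discrete k)" if "f \<in> E" "k \<in> D" for f k
    using T(4)[OF that(1)] apply_restr[of D "T f" "discrete k"] that(2) by (simp add: discrete_inverse)
  with T show ?thesis unfolding E_def Y_def by blast
qed

end
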